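(* Let $\mathfrak{g}$ be the Lie algebra of a compact finite-dimensional simple Lie group $G$. For every non-zero element $\xi\in\mathfrak{g}$ there exists $m\in\mathbb{N}$ such that $\mathcal{V}_{\xi,m}$ contains an open neighbourhood of $0$ in $\mathfrak{g}$.
   Context: For a non-zero $\xi\in\mathfrak{g}$, let $\mathcal{V}_{\xi}=\{\mathrm{Ad}_{g}\,\xi\mid g\in G\}$ be the adjoint orbit of $\xi$, and for $m\in\mathbb{N}$ (a positive integer) let $$\mathcal{V}_{\xi,m}=\underbrace{\mathcal{V}_{\xi}+\ldots+\mathcal{V}_{\xi}}_{m}=\{\eta_1+\cdots+\eta_m\mid \eta_i\in\mathcal{V}_\xi\}.$$ A simple Lie group is one whose Lie algebra is simple (real, non-abelian, with no ideals other than $0$ and itself). *)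

theory Defs
  imports "HOL-Analysis.Analysis" "HOL-Algebra.Group" "HOL-Library.Function_Algebras"
begin

instantiation "fun" :: (type, real_vector) real_vector
begin

definition scaleR_fun :: "real \<Rightarrow> ('a \<Rightarrow> 'b) \<Rightarrow> 'a \<Rightarrow> 'b" where
  "scaleR_fun r f = (\<lambda>x. r *\<^sub>R f x)"

instance
  by standard (auto simp: scaleR_fun_def fun_eq_iff scaleR_add_right scaleR_add_left)

end

primrec Ck_on ::
  "nat \<Rightarrow> 'a::euclidean_space set \<Rightarrow> ('a \<Rightarrow> 'b::euclidean_space) \<Rightarrow> bool" where
  "Ck_on 0 S f \<longleftrightarrow> continuous_on S f"
| "Ck_on (Suc k) S f \<longleftrightarrow> (\<forall>x\<in>S. f differentiable (at x)) \<and>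
     (\<forall>v. Ck_on k S (\<lambda>x. frechet_derivative f (at x) v))"

text \<open>Only used on open sets, as the derivatives are those of the ambient space.\<close>

definition smooth_on :: "'a::euclidean_space set \<Rightarrow> ('a \<Rightarrow> 'b::euclidean_space) \<Rightarrow> bool" where
  "smooth_on S f \<longleftrightarrow> (\<forall>k. Ck_on k S f)"

type_synonym ('p, 'e) chart = "'p set \<times> ('p \<Rightarrow> 'e)"

definition is_chart :: "'p topology \<Rightarrow> ('p, 'e::euclidean_space) chart \<Rightarrow> bool" where
  "is_chart M c \<longleftrightarrow> openin M (fst c) \<and>
     (\<exists>V. open V \<and> homeomorphic_map (subtopology M (fst c)) (top_of_set V) (snd c))"

abbreviation chart_inv :: "('p, 'e) chart \<Rightarrow> 'e \<Rightarrow> 'p" where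
  "chart_inv c \<equiv> inv_into (fst c) (snd c)"

definition local_rep ::
  "('p, 'e) chart \<Rightarrow> ('q, 'f) chart \<Rightarrow> ('p \<Rightarrow> 'q) \<Rightarrow> 'e \<Rightarrow> 'f" where
  "local_rep c d F = snd d \<circ> F \<circ> chart_inv c"

text \<open>
  The atlas need not be maximal. The model space has positive dimension, so this excludes
  zero-dimensional manifolds; a Lie group of dimension zero is never simple.
\<close>

locale smooth_manifold =
  fixes M :: "'p topology" and A :: "('p, 'e::euclidean_space) chart set"
  assumes hausdorff: "Hausdorff_space M"
    and second_countable: "second_countable M"
    and charts: "\<And>c. c \<in> A \<Longrightarrow> is_chart M c"
    and cover: "(\<Union>c\<in>A. fst c) = topspace M"
    and compatible: "\<And>c d. c \<in> A \<Longrightarrow> d \<in> A \<Longrightarrow>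
      smooth_on (snd c ` (fst c \<inter> fst d)) (local_rep c d (\<lambda>p. p))"

definition smooth_map ::
  "'p topology \<Rightarrow> ('p, 'e::euclidean_space) chart set \<Rightarrow>
   'q topology \<Rightarrow> ('q, 'f::euclidean_space) chart set \<Rightarrow> ('p \<Rightarrow> 'q) \<Rightarrow> bool" where
  "smooth_map M A N B F \<longleftrightarrow> continuous_map M N F \<and>
     (\<forall>c\<in>A. \<forall>d\<in>B. smooth_on (snd c ` (fst c \<inter> F -` fst d)) (local_rep c d F))"

definition prod_atlas ::
  "('p, 'e) chart set \<Rightarrow> ('q, 'f) chart set \<Rightarrow> ('p \<times> 'q, 'e \<times> 'f) chart set" where
  "prod_atlas A B = {(fst c \<times> fst d, map_prod (snd c) (snd d)) | c d. c \<in> A \<and> d \<in> B}"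

text \<open>
  A tangent vector at \<open>p\<close> is the family of its coordinate vectors, one for each chart of the
  atlas around \<open>p\<close>, which are related by the derivatives of the transition maps; the family is
  extended by \<open>0\<close> to all other pairs of a set and a map. Evaluation at any one chart of the atlas
  around \<open>p\<close> is a bijection onto the model space. Hence the vector space operations on
  \<open>tangent_space A p\<close> are the pointwise ones, and its topology as a finite-dimensional vector space
  is the subspace topology induced by the (product) topology of the function type.
\<close>

definition tangent_space ::
  "('p, 'e::euclidean_space) chart set \<Rightarrow> 'p \<Rightarrow> (('p, 'e) chart \<Rightarrow> 'e) set" where
  "tangent_space A p =
     {v. (\<forall>c. \<not> (c \<in> A \<and> p \<in> fst c) \<longrightarrow> v c = 0) \<and>
         (\<forall>c\<in>A. \<forall>d\<in>A. p \<in> fst c \<and> p \<in> fst d \<longrightarrow>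
            v d = frechet_derivative (local_rep c d (\<lambda>q. q)) (at (snd c p)) (v c))}"

text \<open>
  The differential of \<open>F\<close> at \<open>p\<close>. By the chain rule it does not depend on the chart \<open>c\<close> around \<open>p\<close>
  in which the argument is read off.
\<close>

definition differential ::
  "('p, 'e::euclidean_space) chart set \<Rightarrow> ('q, 'f::euclidean_space) chart set \<Rightarrow> ('p \<Rightarrow> 'q) \<Rightarrow>
   'p \<Rightarrow> (('p, 'e) chart \<Rightarrow> 'e) \<Rightarrow> ('q, 'f) chart \<Rightarrow> 'f" where
  "differential A B F p v =
     (\<lambda>d. if d \<in> B \<and> F p \<in> fst d
           then (let c = (SOME c. c \<in> A \<and> p \<in> fst c)
                 in frechet_derivative (local_rep c d F) (at (snd c p)) (v c))
           else 0)"

text \<open>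
  This is the coordinate form of \<open>V W - W V\<close>, vector fields being regarded as derivations.
\<close>

definition field_bracket ::
  "('p, 'e::euclidean_space) chart set \<Rightarrow> ('p \<Rightarrow> ('p, 'e) chart \<Rightarrow> 'e) \<Rightarrow>
   ('p \<Rightarrow> ('p, 'e) chart \<Rightarrow> 'e) \<Rightarrow> 'p \<Rightarrow> ('p, 'e) chart \<Rightarrow> 'e" where
  "field_bracket A V W p =
     (\<lambda>c. if c \<in> A \<and> p \<in> fst c
           then frechet_derivative (\<lambda>x. W (chart_inv c x) c) (at (snd c p)) (V p c)
              - frechet_derivative (\<lambda>x. V (chart_inv c x) c) (at (snd c p)) (W p c)
           else 0)"

locale lie_group = group G + smooth_manifold M A
  for G :: "('g, 'm) monoid_scheme" (structure)
    and M :: "'g topology" and A :: "('g, 'e::euclidean_space) chart set" +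
  assumes carrier_eq: "carrier G = topspace M"
    and smooth_mult:
      "smooth_map (prod_topology M M) (prod_atlas A A) M A (\<lambda>(g, h). g \<otimes> h)"
    and smooth_inv: "smooth_map M A M A (\<lambda>g. inv g)"

definition lie_algebra ::
  "('g, 'm) monoid_scheme \<Rightarrow> ('g, 'e::euclidean_space) chart set \<Rightarrow> (('g, 'e) chart \<Rightarrow> 'e) set" where
  "lie_algebra G A = tangent_space A \<one>\<^bsub>G\<^esub>"

definition left_invariant_field ::
  "('g, 'm) monoid_scheme \<Rightarrow> ('g, 'e::euclidean_space) chart set \<Rightarrow>
   (('g, 'e) chart \<Rightarrow> 'e) \<Rightarrow> 'g \<Rightarrow> ('g, 'e) chart \<Rightarrow> 'e" where
  "left_invariant_field G A \<xi> g = differential A A (\<lambda>h. g \<otimes>\<^bsub>G\<^esub> h) \<one>\<^bsub>G\<^esub> \<xi>"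

definition lie_bracket ::
  "('g, 'm) monoid_scheme \<Rightarrow> ('g, 'e::euclidean_space) chart set \<Rightarrow>
   (('g, 'e) chart \<Rightarrow> 'e) \<Rightarrow> (('g, 'e) chart \<Rightarrow> 'e) \<Rightarrow> ('g, 'e) chart \<Rightarrow> 'e" where
  "lie_bracket G A \<xi> \<eta> =
     field_bracket A (left_invariant_field G A \<xi>) (left_invariant_field G A \<eta>) \<one>\<^bsub>G\<^esub>"

definition Ad ::
  "('g, 'm) monoid_scheme \<Rightarrow> ('g, 'e::euclidean_space) chart set \<Rightarrow>
   'g \<Rightarrow> (('g, 'e) chart \<Rightarrow> 'e) \<Rightarrow> ('g, 'e) chart \<Rightarrow> 'e" where
  "Ad G A g = differential A A (\<lambda>h. g \<otimes>\<^bsub>G\<^esub> h \<otimes>\<^bsub>G\<^esub> inv\<^bsub>G\<^esub> g) \<one>\<^bsub>G\<^esub>"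

definition lie_ideal :: "'v::real_vector set \<Rightarrow> ('v \<Rightarrow> 'v \<Rightarrow> 'v) \<Rightarrow> 'v set \<Rightarrow> bool" where
  "lie_ideal L br I \<longleftrightarrow> I \<subseteq> L \<and> subspace I \<and> (\<forall>x\<in>L. \<forall>y\<in>I. br x y \<in> I)"

definition simple_lie_algebra :: "'v::real_vector set \<Rightarrow> ('v \<Rightarrow> 'v \<Rightarrow> 'v) \<Rightarrow> bool" where
  "simple_lie_algebra L br \<longleftrightarrow>
     (\<exists>x\<in>L. \<exists>y\<in>L. br x y \<noteq> 0) \<and> (\<forall>I. lie_ideal L br I \<longrightarrow> I = {0} \<or> I = L)"

definition simple_lie_group ::
  "('g, 'm) monoid_scheme \<Rightarrow> 'g topology \<Rightarrow> ('g, 'e::euclidean_space) chart set \<Rightarrow> bool" where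
  "simple_lie_group G M A \<longleftrightarrow>
     lie_group G M A \<and> simple_lie_algebra (lie_algebra G A) (lie_bracket G A)"

definition adjoint_orbit ::
  "('g, 'm) monoid_scheme \<Rightarrow> ('g, 'e::euclidean_space) chart set \<Rightarrow>
   (('g, 'e) chart \<Rightarrow> 'e) \<Rightarrow> (('g, 'e) chart \<Rightarrow> 'e) set" where
  "adjoint_orbit G A \<xi> = {Ad G A g \<xi> | g. g \<in> carrier G}"

definition orbit_sum ::
  "('g, 'm) monoid_scheme \<Rightarrow> ('g, 'e::euclidean_space) chart set \<Rightarrow>
   (('g, 'e) chart \<Rightarrow> 'e) \<Rightarrow> nat \<Rightarrow> (('g, 'e) chart \<Rightarrow> 'e) set" where
  "orbit_sum G A \<xi> m = {\<Sum>i<m. \<eta> i | \<eta>. \<forall>i<m. \<eta> i \<in> adjoint_orbit G A \<xi>}"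

end

theory Submission
  imports Defs
begin

text \<open>
  The span of an orbit, or of the vectors \<open>Ad g [u, \<xi>]\<close>, is \<open>Ad\<close>-invariant, hence an ideal, because
  the derivative of \<open>Ad\<close> is the bracket; by simplicity the vectors \<open>Ad g [u, \<xi>]\<close> span the Lie
  algebra. A basis chosen among them consists of tangent vectors to the orbit, so the sum of \<open>dim\<close>
  copies of the orbit contains a ball around some point \<open>p\<close>, by an open mapping theorem. Since the
  group is compact, the convex hull of the orbit of \<open>p\<close> contains a fixed vector, and a fixed vector
  is central, hence \<open>0\<close>. Write \<open>0\<close> as a convex combination of points \<open>q\<close> of this orbit and replace
  \<open>n\<close> times the coefficients by integers: the resulting integer combination of the \<open>q\<close> stays
  bounded, whereas the radius of the ball around it that is covered grows linearly in \<open>n\<close>, so for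
  large \<open>n\<close> the ball contains a neighbourhood of \<open>0\<close>.
\<close>

section \<open>Sums of orbits of a compact linear group\<close>

text \<open>Three obstacles shape the proof. A sum of orbits is stable under addition and under the
  group, but not under negation or real scaling, and the negative of a vector need not lie in its
  orbit. So the origin cannot be reached as a difference of two interior points; a convex
  combination with value 0 has to serve instead.

  No exponential map is developed. The open mapping theorem used here asks only for continuity near
  a point and a surjective derivative at that point, so a straight line in a chart through
  \<open>\<one>\<close> can replace a one-parameter subgroup, and \<open>Ad\<close> has to be
  differentiated only at \<open>\<one>\<close>. For the same reason ideals are obtained from
  invariant subspaces: this direction is plain differentiation, whereas the converse would in
  general call for integration and for a connected group.

  Finally, tangent vectors are functions on charts, and their type is not a Euclidean space. The
  analysis is therefore carried out in a locale over a Euclidean space, which is reached by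
  evaluation in one chart around \<open>\<one>\<close>.\<close>

definition sumset :: "'v::comm_monoid_add set \<Rightarrow> nat \<Rightarrow> 'v set" where
  "sumset V m = {\<Sum>i<m. \<eta> i | \<eta>. \<forall>i<m. \<eta> i \<in> V}"

lemma sumset_0 [simp]: "sumset V 0 = {0}"
  by (auto simp: sumset_def)

lemma sumset_1: "x \<in> V \<Longrightarrow> x \<in> sumset V 1"
  by (auto simp: sumset_def intro!: exI[of _ "\<lambda>_. x"])

lemma sumset_Suc:
  assumes "x \<in> V" "y \<in> sumset V m"
  shows "y + x \<in> sumset V (Suc m)"
proof -
  obtain \<eta> where \<eta>: "y = (\<Sum>i<m. \<eta> i)" "\<forall>i<m. \<eta> i \<in> V"
    using assms(2) by (auto simp: sumset_def)
  have "y + x = (\<Sum>i<Suc m. (\<eta>(m := x)) i)"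
    using \<eta>(1) by simp
  moreover have "\<forall>i<Suc m. (\<eta>(m := x)) i \<in> V"
    using \<eta>(2) assms(1) by (auto simp: less_Suc_eq)
  ultimately show ?thesis
    unfolding sumset_def by blast
qed

lemma sumset_SucE:
  assumes "y \<in> sumset V (Suc m)"
  obtains z x where "y = z + x" "x \<in> V" "z \<in> sumset V m"
  using assms by (force simp: sumset_def)

lemma sumset_add:
  assumes "x \<in> sumset V m" "y \<in> sumset V n"
  shows "x + y \<in> sumset V (m + n)"
  using assms(2)
proof (induction n arbitrary: y)
  case 0
  then show ?case using assms(1) by simp
next
  case (Suc n)
  then obtain z v where "y = z + v" "v \<in> V" "z \<in> sumset V n"
    by (elim sumset_SucE)
  then show ?case
    using sumset_Suc[of v V "x + z" "m + n"] Suc.IH[of z] by (simp add: add.assoc)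
qed

lemma sumset_sum:
  assumes "finite I" "\<And>i. i \<in> I \<Longrightarrow> f i \<in> sumset V (n i)"
  shows "(\<Sum>i\<in>I. f i) \<in> sumset V (\<Sum>i\<in>I. n i)"
  using assms by (induction I) (auto intro: sumset_add)

lemma sumset_scaleR:
  fixes V :: "'v::real_vector set"
  assumes "x \<in> sumset V m"
  shows "real k *\<^sub>R x \<in> sumset V (k * m)"
proof -
  have "(\<Sum>i<k. x) \<in> sumset V (\<Sum>i<k. m)"
    by (intro sumset_sum) (auto simp: assms)
  then show ?thesis
    by (simp add: sum_constant_scaleR)
qed

lemma sumset_linear_image:
  assumes "linear f" "\<And>v. v \<in> V \<Longrightarrow> f v \<in> V" "x \<in> sumset V m"
  shows "f x \<in> sumset V m"
proof -
  obtain \<eta> where \<eta>: "x = (\<Sum>i<m. \<eta> i)" "\<forall>i<m. \<eta> i \<in> V"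
    using assms(3) by (auto simp: sumset_def)
  then have "f x = (\<Sum>i<m. f (\<eta> i))"
    by (simp add: linear_sum[OF assms(1)])
  then show ?thesis
    using \<eta>(2) assms(2) unfolding sumset_def by blast
qed

text \<open>The difference quotients lie in \<open>W\<close>, and a subspace of a Euclidean space is
  closed. This is what turns invariance under the group into invariance under the bracket.\<close>

lemma has_vector_derivative_in_subspace:
  fixes f :: "real \<Rightarrow> 'v::euclidean_space"
  assumes W: "subspace W" and \<epsilon>: "0 < \<epsilon>" "\<And>t. \<bar>t\<bar> < \<epsilon> \<Longrightarrow> f t \<in> W"
    and f: "(f has_vector_derivative D) (at 0)"
  shows "D \<in> W"
proof -
  have "((\<lambda>h. (f h - f 0) /\<^sub>R h) \<longlongrightarrow> D) (at 0)"
    using f[unfolded has_vector_derivative_def has_derivative_at2]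
  proof (elim conjE)
    assume "((\<lambda>y. (1 / norm (y - 0)) *\<^sub>R (f y - (f 0 + (y - 0) *\<^sub>R D))) \<longlongrightarrow> 0) (at (0::real))"
    then have "((\<lambda>y. norm ((f y - f 0) /\<^sub>R y - D)) \<longlongrightarrow> 0) (at (0::real))"
    proof (rule Lim_transform_within[OF tendsto_norm_zero, OF _ zero_less_one])
      fix y :: real assume "0 < dist y 0"
      then have y: "y \<noteq> 0" by auto
      then have "norm ((f y - f 0) /\<^sub>R y - D) = norm ((1 / y) *\<^sub>R (f y - (f 0 + y *\<^sub>R D)))"
        by (simp add: algebra_simps divide_inverse)
      then show "norm ((1 / norm (y - 0)) *\<^sub>R (f y - (f 0 + (y - 0) *\<^sub>R D)))
          = norm ((f y - f 0) /\<^sub>R y - D)"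
        by simp
    qed
    then show ?thesis
      using Lim_null tendsto_norm_zero_iff by blast
  qed
  moreover have "eventually (\<lambda>h. (f h - f 0) /\<^sub>R h \<in> W) (at 0)"
    unfolding eventually_at
    using \<epsilon> W by (intro exI[of _ \<epsilon>]) (auto intro!: subspace_diff subspace_scale)
  ultimately show ?thesis
    using Lim_in_closed_set[OF closed_subspace[OF W]] by (metis trivial_limit_at)
qed

text \<open>The properties of \<open>Ad\<close>, read in one chart, on which the argument rests. The
  assumption \<open>curve\<close> stands in for the exponential map, with continuity on an interval
  and a derivative at 0 only; it is also what ties \<open>br\<close> to the group.\<close>

locale compact_adjoint_rep = group G
  for G :: "('g, 'm) monoid_scheme" (structure) +
  fixes M :: "'g topology" and a :: "'g \<Rightarrow> 'v::euclidean_space \<Rightarrow> 'v" and br :: "'v \<Rightarrow> 'v \<Rightarrow> 'v"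
  assumes carrier_eq: "carrier G = topspace M"
    and compact: "compact_space M"
    and linear_a: "g \<in> carrier G \<Longrightarrow> linear (a g)"
    and a_mult: "g \<in> carrier G \<Longrightarrow> h \<in> carrier G \<Longrightarrow> a (g \<otimes> h) v = a g (a h v)"
    and a_one: "a \<one> v = v"
    and continuous_a: "continuous_map M euclidean (\<lambda>g. a g v)"
    and curve: "\<exists>\<gamma> \<epsilon>. 0 < \<epsilon> \<and> \<gamma> 0 = \<one> \<and> (\<forall>t. \<bar>t\<bar> < \<epsilon> \<longrightarrow> \<gamma> t \<in> carrier G) \<and>
      (\<forall>v. continuous_on {-\<epsilon><..<\<epsilon>} (\<lambda>t. a (\<gamma> t) v) \<and>
           ((\<lambda>t. a (\<gamma> t) v) has_vector_derivative br u v) (at 0))"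
    and nonabelian: "\<exists>u v. br u v \<noteq> 0"
    and ideal_trivial: "subspace I \<Longrightarrow> (\<And>u v. v \<in> I \<Longrightarrow> br u v \<in> I) \<Longrightarrow> I = {0} \<or> I = UNIV"
begin

definition orbit :: "'v \<Rightarrow> 'v set" where
  "orbit v = (\<lambda>g. a g v) ` carrier G"

lemma self_in_orbit: "v \<in> orbit v"
  unfolding orbit_def by (rule image_eqI[of _ _ \<one>]) (simp_all add: a_one)

lemma a_in_orbit:
  assumes g: "g \<in> carrier G" and "w \<in> orbit v"
  shows "a g w \<in> orbit v"
proof -
  obtain h where h: "h \<in> carrier G" "w = a h v"
    using assms(2) by (auto simp: orbit_def)
  show ?thesis
    unfolding orbit_def using g h by (intro image_eqI[of _ _ "g \<otimes> h"]) (simp_all add: a_mult)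
qed

lemma a_inv:
  assumes "g \<in> carrier G"
  shows "a (inv g) (a g v) = v" "a g (a (inv g) v) = v"
  using assms by (simp_all add: a_one flip: a_mult)

lemma compact_orbit: "compact (orbit v)"
proof -
  have "compactin euclidean ((\<lambda>g. a g v) ` topspace M)"
    using image_compactin[OF compact[unfolded compact_space_def] continuous_a] .
  then show ?thesis
    by (simp add: orbit_def carrier_eq)
qed

text \<open>Linearity of \<open>br\<close> is not among the axioms; homogeneity is inherited from
  the linear maps \<open>a (\<gamma> t)\<close> by uniqueness of derivatives.\<close>

lemma br_scale: "br u (c *\<^sub>R v) = c *\<^sub>R br u v"
proof -
  obtain \<gamma> \<epsilon> where \<gamma>: "0 < \<epsilon>" "\<forall>t. \<bar>t\<bar> < \<epsilon> \<longrightarrow> \<gamma> t \<in> carrier G"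
    "\<And>v. ((\<lambda>t. a (\<gamma> t) v) has_vector_derivative br u v) (at 0)"
    using curve[of u] by blast
  have "((\<lambda>t. a (\<gamma> t) (c *\<^sub>R v)) has_vector_derivative c *\<^sub>R br u v) (at 0)"
  proof (rule has_vector_derivative_transform_within_open)
    show "((\<lambda>t. c *\<^sub>R a (\<gamma> t) v) has_vector_derivative c *\<^sub>R br u v) (at 0)"
      using \<gamma>(3) by (auto intro!: derivative_eq_intros)
    show "c *\<^sub>R a (\<gamma> t) v = a (\<gamma> t) (c *\<^sub>R v)" if "t \<in> {-\<epsilon><..<\<epsilon>}" for t
      using that \<gamma>(2) linear_a by (simp add: abs_less_iff linear_scale)
  qed (use \<gamma>(1) in auto)
  then show ?thesis
    using \<gamma>(3) vector_derivative_unique_at by blast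
qed

text \<open>Differentiating \<open>a (\<gamma> t) w\<close> at 0 stays inside \<open>W\<close>, so
  an invariant subspace is an ideal.\<close>

lemma invariant_subspace_trivial:
  assumes W: "subspace W" and inv: "\<And>g w. g \<in> carrier G \<Longrightarrow> w \<in> W \<Longrightarrow> a g w \<in> W"
  shows "W = {0} \<or> W = UNIV"
proof (rule ideal_trivial[OF W])
  fix u w assume w: "w \<in> W"
  obtain \<gamma> \<epsilon> where \<gamma>: "0 < \<epsilon>" "\<forall>t. \<bar>t\<bar> < \<epsilon> \<longrightarrow> \<gamma> t \<in> carrier G"
    "\<And>v. ((\<lambda>t. a (\<gamma> t) v) has_vector_derivative br u v) (at 0)"
    using curve[of u] by blast
  show "br u w \<in> W"
    using has_vector_derivative_in_subspace[OF W \<gamma>(1) _ \<gamma>(3)] \<gamma>(2) inv w by blast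
qed

text \<open>A central vector spans an ideal of dimension at most 1. If it were the whole algebra,
  homogeneity would make every bracket vanish.\<close>

lemma central_zero:
  assumes "\<And>u. br u v = 0"
  shows "v = 0"
proof (rule ccontr)
  assume "v \<noteq> 0"
  have "span {v} = {0} \<or> span {v} = UNIV"
    by (rule ideal_trivial[OF subspace_span]) (auto simp: span_singleton br_scale assms)
  with \<open>v \<noteq> 0\<close> have "span {v} = UNIV"
    using span_base[of v "{v}"] by auto
  then have "w \<in> range (\<lambda>c. c *\<^sub>R v)" for w
    by (simp add: span_singleton)
  then have "br u w = 0" for u w
    using br_scale[of u _ v] assms[of u] by (auto elim!: rangeE[of w])
  then show False
    using nonabelian by simp
qed

text \<open>A fixed vector is constant along every curve of the group, so its brackets are
  derivatives of constants and it is central.\<close>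

lemma fixed_zero:
  assumes "\<And>g. g \<in> carrier G \<Longrightarrow> a g v = v"
  shows "v = 0"
proof (rule central_zero)
  fix u
  obtain \<gamma> \<epsilon> where \<gamma>: "0 < \<epsilon>" "\<forall>t. \<bar>t\<bar> < \<epsilon> \<longrightarrow> \<gamma> t \<in> carrier G"
    "\<And>v. ((\<lambda>t. a (\<gamma> t) v) has_vector_derivative br u v) (at 0)"
    using curve[of u] by blast
  have "((\<lambda>t. a (\<gamma> t) v) has_vector_derivative 0) (at 0)"
  proof (rule has_vector_derivative_transform_within_open)
    show "((\<lambda>t. v) has_vector_derivative 0) (at (0::real))" by simp
    show "v = a (\<gamma> t) v" if "t \<in> {-\<epsilon><..<\<epsilon>}" for t
      using that \<gamma>(2) assms by (simp add: abs_less_iff)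
  qed (use \<gamma>(1) in auto)
  then show "br u v = 0"
    using \<gamma>(3) vector_derivative_unique_at by blast
qed

section \<open>A fixed vector from an invariant norm\<close>

definition sup_norm :: "'v \<Rightarrow> real" where
  "sup_norm v = Sup (norm ` orbit v)"

lemma norm_le_sup_norm: "w \<in> orbit v \<Longrightarrow> norm w \<le> sup_norm v"
proof -
  assume w: "w \<in> orbit v"
  have "bdd_above (norm ` orbit v)"
    using compact_imp_bounded[OF compact_orbit, of v] bounded_norm_comp[of "\<lambda>x. x" "orbit v"]
    by (intro bounded_imp_bdd_above) (simp add: image_image)
  then show ?thesis
    unfolding sup_norm_def using w by (intro cSup_upper) auto
qed

text \<open>Attainment lets one group element realise the value, so that properties of the Euclidean
  norm, such as the parallelogram law, can be applied at that element.\<close>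

lemma sup_norm_attained: "\<exists>w\<in>orbit v. norm w = sup_norm v"
proof -
  obtain w where w: "w \<in> orbit v" "\<forall>y\<in>orbit v. norm y \<le> norm w"
    using continuous_attains_sup[OF compact_orbit, of v norm] self_in_orbit[of v]
    by (metis continuous_on_norm_id empty_iff)
  have "sup_norm v = norm w"
    unfolding sup_norm_def using w by (intro cSup_eq_maximum) auto
  then show ?thesis using w by auto
qed

text \<open>Serves to obtain continuity: a real convex function on all of a Euclidean space is
  continuous.\<close>

lemma convex_on_sup_norm: "convex_on UNIV sup_norm"
proof (rule convex_onI)
  fix t :: real and x y assume t: "0 < t" "t < 1"
  obtain g where g: "g \<in> carrier G" "norm (a g ((1 - t) *\<^sub>R x + t *\<^sub>R y)) = sup_norm ((1 - t) *\<^sub>R x + t *\<^sub>R y)"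
    using sup_norm_attained[of "(1 - t) *\<^sub>R x + t *\<^sub>R y"] by (auto simp: orbit_def)
  have "norm (a g ((1 - t) *\<^sub>R x + t *\<^sub>R y)) \<le> norm ((1 - t) *\<^sub>R a g x) + norm (t *\<^sub>R a g y)"
    using linear_a[OF g(1)] by (simp only: linear_add linear_scale norm_triangle_ineq)
  also have "\<dots> \<le> (1 - t) * sup_norm x + t * sup_norm y"
    using t g(1) by (auto intro!: add_mono mult_left_mono norm_le_sup_norm simp: orbit_def)
  finally show "sup_norm ((1 - t) *\<^sub>R x + t *\<^sub>R y) \<le> (1 - t) * sup_norm x + t * sup_norm y"
    using g by simp
qed auto

text \<open>
  By the parallelogram law the invariant function \<open>sup_norm\<close> has a unique minimiser on the compact
  convex hull of the orbit, which is therefore fixed by the group. This replaces averaging over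
  Haar measure.
\<close>

lemma zero_in_convex_hull_orbit: "0 \<in> convex hull (orbit v)"
proof -
  let ?K = "convex hull (orbit v)"
  have cpt: "compact ?K"
    by (rule compact_convex_hull[OF compact_orbit])
  have "continuous_on ?K sup_norm"
    using convex_on_continuous[OF open_UNIV convex_on_sup_norm] continuous_on_subset by blast
  moreover have "?K \<noteq> {}" using self_in_orbit[of v] by auto
  ultimately obtain z where z: "z \<in> ?K" "\<And>y. y \<in> ?K \<Longrightarrow> sup_norm z \<le> sup_norm y"
    using continuous_attains_inf[OF cpt] by blast
  have "a g z = z" if g: "g \<in> carrier G" for g
  proof -
    have "a g ` ?K \<subseteq> ?K"
    proof -
      have "a g ` ?K = convex hull (a g ` orbit v)"
        using linear_a[OF g] by (rule convex_hull_linear_image)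
      also have "\<dots> \<subseteq> ?K"
        using a_in_orbit[OF g] by (intro hull_mono) auto
      finally show ?thesis .
    qed
    then have "a g z \<in> ?K" using z(1) by blast
    then have mid: "(1/2) *\<^sub>R z + (1/2) *\<^sub>R a g z \<in> ?K"
      using z(1) by (intro convexD[OF convex_convex_hull]) auto
    \<comment> \<open>Take \<open>h\<close> realising the value at the midpoint. Then
      \<open>?x\<close> and \<open>?y\<close> have norm at most the minimum, while their sum has
      norm at least twice the minimum; the parallelogram law leaves no room for a
      difference.\<close>
    obtain h where h: "h \<in> carrier G"
      "norm (a h ((1/2) *\<^sub>R z + (1/2) *\<^sub>R a g z)) = sup_norm ((1/2) *\<^sub>R z + (1/2) *\<^sub>R a g z)"
      using sup_norm_attained[of "(1/2) *\<^sub>R z + (1/2) *\<^sub>R a g z"] by (auto simp: orbit_def)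
    let ?x = "a h z" and ?y = "a h (a g z)"
    have "norm ?x \<le> sup_norm z"
      using h by (intro norm_le_sup_norm) (auto simp: orbit_def)
    moreover have "norm ?y \<le> sup_norm z"
      using h g a_in_orbit self_in_orbit by (intro norm_le_sup_norm) blast
    moreover have "sup_norm z \<le> norm ((1/2) *\<^sub>R (?x + ?y))"
      using z(2)[OF mid] h(2) linear_a[OF h(1)] by (simp add: linear_add linear_scale scaleR_add_right)
    then have "2 * sup_norm z \<le> norm (?x + ?y)" by simp
    moreover have "0 \<le> sup_norm z"
      using norm_le_sup_norm[OF self_in_orbit, of z] norm_ge_zero order_trans by blast
    moreover have "(norm (?x + ?y))\<^sup>2 + (norm (?x - ?y))\<^sup>2 = 2 * (norm ?x)\<^sup>2 + 2 * (norm ?y)\<^sup>2"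
      by (simp add: power2_norm_eq_inner algebra_simps inner_commute)
    moreover from calculation have "(norm ?x)\<^sup>2 \<le> (sup_norm z)\<^sup>2" "(norm ?y)\<^sup>2 \<le> (sup_norm z)\<^sup>2"
      "(2 * sup_norm z)\<^sup>2 \<le> (norm (?x + ?y))\<^sup>2"
      by (simp_all only: power_mono norm_ge_zero mult_nonneg_nonneg zero_le_numeral)
    ultimately have "(norm (?x - ?y))\<^sup>2 \<le> 0" unfolding power_mult_distrib power2_eq_square[of "2::real"]
      by linarith
    then have "?x = ?y" by simp
    then show "a g z = z"
      by (metis a_inv(1) h(1))
  qed
  then have "z = 0" by (rule fixed_zero)
  then show ?thesis using z by simp
qed

section \<open>Interior points of orbit sums and the neighbourhood of 0\<close>

lemma span_brackets:
  assumes "v \<noteq> 0"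
  shows "span {a g (br u v) | g u. g \<in> carrier G} = UNIV" (is "span ?S = _")
proof -
  have "a g w \<in> span ?S" if g: "g \<in> carrier G" and w: "w \<in> span ?S" for g w
  proof -
    have "a g w \<in> span (a g ` ?S)"
      using linear_span_image[OF linear_a[OF g]] w by blast
    also have "a g ` ?S \<subseteq> ?S"
      using g by (auto simp: a_mult[symmetric]) blast
    then have "span (a g ` ?S) \<subseteq> span ?S" by (rule span_mono)
    finally show ?thesis .
  qed
  then have "span ?S = {0} \<or> span ?S = UNIV"
    by (intro invariant_subspace_trivial) auto
  \<comment> \<open>Excludes the zero span: a non-zero \<open>v\<close> is not central, and the
    choice \<open>g = \<one>\<close> puts its bracket into the generating set.\<close>
  moreover obtain u where "br u v \<noteq> 0"
    using central_zero assms by blast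
  moreover have "br u v \<in> ?S"
    using a_one one_closed by (metis (mono_tags, lifting) mem_Collect_eq)
  ultimately show ?thesis
    by (metis (no_types, lifting) singletonD span_base)
qed

lemma sumset_orbit_has_interior:
  assumes v: "v \<noteq> 0"
  shows "\<exists>p. p \<in> interior (sumset (orbit v) DIM('v))"
proof -
  obtain B where B: "B \<subseteq> {a g (br u v) | g u. g \<in> carrier G}" "independent B" "span B = UNIV"
    using maximal_independent_subset span_brackets[OF v] span_mono span_span
    by (metis (no_types, lifting) UNIV_I subsetI subset_antisym)
  have "card B = DIM('v)" "finite B"
    using B(2,3) by (metis dim_UNIV dim_eq_card_independent dim_span) (use B(2) finiteI_independent in blast)
  \<comment> \<open>Indexing the spanning vectors by \<open>Basis\<close> lets the curve parameters
    be the coordinates of a single vector, so that \<open>f\<close> below maps between spaces of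
    equal dimension.\<close>
  then obtain e where e: "bij_betw e (Basis :: 'v set) B"
    using finite_same_card_bij[OF finite_Basis] by metis
  have "\<exists>g u. g \<in> carrier G \<and> e b = a g (br u v)" if "b \<in> Basis" for b
    using e B(1) that bij_betwE by blast
  then obtain g u where gu: "\<And>b. b \<in> Basis \<Longrightarrow> g b \<in> carrier G" "\<And>b. b \<in> Basis \<Longrightarrow> e b = a (g b) (br (u b) v)"
    by metis
  have "\<exists>\<gamma> \<epsilon>. 0 < \<epsilon> \<and> (\<forall>t. \<bar>t\<bar> < \<epsilon> \<longrightarrow> \<gamma> t \<in> carrier G) \<and>
      continuous_on {-\<epsilon><..<\<epsilon>} (\<lambda>t. a (\<gamma> t) v) \<and>
      ((\<lambda>t. a (\<gamma> t) v) has_vector_derivative br (u b) v) (at 0)" for b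
    using curve[of "u b"] by blast
  then obtain \<gamma> \<epsilon> where \<gamma>: "\<And>b. 0 < \<epsilon> b" "\<And>b t. \<bar>t\<bar> < \<epsilon> b \<Longrightarrow> \<gamma> b t \<in> carrier G"
    "\<And>b. continuous_on {-\<epsilon> b<..<\<epsilon> b} (\<lambda>t. a (\<gamma> b t) v)"
    "\<And>b. ((\<lambda>t. a (\<gamma> b t) v) has_vector_derivative br (u b) v) (at 0)"
    by metis
  define \<delta> where "\<delta> = Min (\<epsilon> ` (Basis :: 'v set))"
  have \<delta>: "0 < \<delta>" "\<And>b. b \<in> Basis \<Longrightarrow> \<delta> \<le> \<epsilon> b"
    using \<gamma>(1) by (auto simp: \<delta>_def)
  have small: "\<bar>x \<bullet> b\<bar> < \<epsilon> b" if "x \<in> ball 0 \<delta>" "b \<in> Basis" for x b :: 'v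
    using that \<delta>(2)[of b] Basis_le_norm[of b x] by simp
  \<comment> \<open>Each summand runs along a curve in the orbit, moved by \<open>g b\<close> so
    that its velocity at 0 is \<open>e b\<close>. Hence the derivative \<open>f'\<close> sends
    \<open>Basis\<close> onto the spanning set \<open>B\<close> and is surjective.\<close>
  define f where "f x = (\<Sum>b\<in>Basis. a (g b) (a (\<gamma> b (x \<bullet> b)) v))" for x :: 'v
  define f' where "f' x = (\<Sum>b\<in>Basis. (x \<bullet> b) *\<^sub>R e b)" for x :: 'v
  have "continuous_on (ball 0 \<delta>) f"
    unfolding f_def
  proof (intro continuous_on_sum)
    fix b :: 'v assume b: "b \<in> Basis"
    have "continuous_on (ball 0 \<delta>) (\<lambda>x. a (\<gamma> b (x \<bullet> b)) v)"
      using small[OF _ b]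
      by (intro continuous_on_compose2[OF \<gamma>(3)[of b]]) (auto intro!: continuous_intros simp: abs_less_iff minus_less_iff)
    then show "continuous_on (ball 0 \<delta>) (\<lambda>x. a (g b) (a (\<gamma> b (x \<bullet> b)) v))"
      using linear_continuous_on_compose linear_a[OF gu(1)[OF b]] by blast
  qed
  moreover have "(f has_derivative f') (at 0)"
    unfolding f_def f'_def
  proof (intro has_derivative_sum)
    fix b :: 'v assume b: "b \<in> Basis"
    have "((\<lambda>x. a (\<gamma> b (x \<bullet> b)) v) has_derivative (\<lambda>x. (x \<bullet> b) *\<^sub>R br (u b) v)) (at 0)"
      using has_derivative_compose[of "\<lambda>x. x \<bullet> b" "\<lambda>x. x \<bullet> b" "0::'v" UNIV "\<lambda>t. a (\<gamma> b t) v" "\<lambda>t. t *\<^sub>R br (u b) v"]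
        \<gamma>(4)[of b] by (simp add: has_vector_derivative_def bounded_linear_imp_has_derivative bounded_linear_inner_left)
    from linear_imp_has_derivative[OF linear_a[OF gu(1)[OF b]], THEN has_derivative_compose[OF this]]
    show "((\<lambda>x. a (g b) (a (\<gamma> b (x \<bullet> b)) v)) has_derivative (\<lambda>x. (x \<bullet> b) *\<^sub>R e b)) (at 0)"
      using linear_a[OF gu(1)[OF b]] by (simp add: linear_scale gu(2)[OF b])
  qed
  moreover obtain g' where "bounded_linear g'" "f' \<circ> g' = id"
  proof -
    have lin: "linear f'"
      unfolding f'_def by (intro linear_compose_sum ballI) (auto intro!: linearI simp: inner_add_left scaleR_add_left)
    have "B \<subseteq> range f'"
    proof
      fix w assume "w \<in> B"
      then obtain b where b: "b \<in> Basis" "w = e b" using e by (auto simp: bij_betw_def)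
      have "f' b = (\<Sum>c\<in>Basis. if c = b then e b else 0)"
        unfolding f'_def using b(1) by (intro sum.cong) (auto simp: inner_Basis)
      then have "f' b = w" using b by simp
      then show "w \<in> range f'" by blast
    qed
    then have "surj f'"
      using span_minimal[of B "range f'"] B(3) linear_subspace_image[OF lin subspace_UNIV] by auto
    then obtain g' where "linear g'" "f' \<circ> g' = id"
      using linear_surjective_right_inverse[OF lin] by blast
    then show ?thesis using that linear_conv_bounded_linear by blast
  qed
  \<comment> \<open>Sussmann's open mapping theorem: continuity on the ball and a right inverse of
    the derivative at the single point 0 suffice.\<close>
  ultimately have "f 0 \<in> interior (f ` ball 0 \<delta>)"
    using sussmann_open_mapping[of "ball 0 \<delta>" f 0 f' g' "ball 0 \<delta>"] \<delta>(1) by simp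
  moreover have "f ` ball 0 \<delta> \<subseteq> sumset (orbit v) DIM('v)"
  proof
    fix y assume "y \<in> f ` ball 0 \<delta>"
    then obtain x where x: "x \<in> ball 0 \<delta>" "y = f x" by blast
    have "y \<in> sumset (orbit v) (\<Sum>b\<in>(Basis :: 'v set). 1)"
      unfolding x(2) f_def
      using gu(1) \<gamma>(2)[OF small[OF x(1)]] a_in_orbit self_in_orbit
      by (intro sumset_sum) (auto intro!: sumset_1[unfolded One_nat_def])
    then show "y \<in> sumset (orbit v) DIM('v)" by simp
  qed
  ultimately show ?thesis
    using interior_mono by blast
qed

theorem sumset_orbit_nhd_zero:
  assumes v: "v \<noteq> 0"
  shows "\<exists>m\<ge>1. \<exists>r>0. ball 0 r \<subseteq> sumset (orbit v) m"
proof -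
  let ?d = "DIM('v)"
  obtain p where p: "p \<in> interior (sumset (orbit v) ?d)"
    using sumset_orbit_has_interior[OF v] by blast
  obtain S c where S: "finite S" "S \<subseteq> orbit p" and
    c: "\<And>q. q \<in> S \<Longrightarrow> 0 \<le> c q" "sum c S = 1" "(\<Sum>q\<in>S. c q *\<^sub>R q) = 0"
    using zero_in_convex_hull_orbit[of p] unfolding convex_hull_explicit by blast
  have "S \<noteq> {}" using c(2) by auto
  \<comment> \<open>Each \<open>a g\<close> is an open map, being linear and surjective, and it maps
    the sumset into itself; so interior points travel along orbits.\<close>
  have int: "q \<in> interior (sumset (orbit v) ?d)" if q: "q \<in> S" for q
  proof -
    obtain g where g: "g \<in> carrier G" "q = a g p" using S q by (auto simp: orbit_def)
    have surj: "surj (a g)" using a_inv(2)[OF g(1)] by (metis surjI)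
    have "q \<in> a g ` interior (sumset (orbit v) ?d)" using g p by blast
    also have "\<dots> \<subseteq> interior (a g ` sumset (orbit v) ?d)"
      using open_surjective_linear_image[OF open_interior linear_a[OF g(1)] surj] interior_subset
      by (intro interior_maximal image_mono)
    also have "\<dots> \<subseteq> interior (sumset (orbit v) ?d)"
      using sumset_linear_image[OF linear_a[OF g(1)] a_in_orbit[OF g(1)]] by (intro interior_mono) auto
    finally show ?thesis .
  qed
  have "\<exists>r>0. ball q r \<subseteq> sumset (orbit v) ?d" if "q \<in> S" for q
    using int[OF that] mem_interior by blast
  then obtain \<rho> where \<rho>: "\<And>q. q \<in> S \<Longrightarrow> 0 < \<rho> q" "\<And>q. q \<in> S \<Longrightarrow> ball q (\<rho> q) \<subseteq> sumset (orbit v) ?d"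
    by metis
  define r where "r = Min (\<rho> ` S)"
  have r: "0 < r" "\<And>q. q \<in> S \<Longrightarrow> ball q r \<subseteq> sumset (orbit v) ?d"
  proof -
    show "0 < r" using \<rho>(1) S \<open>S \<noteq> {}\<close> by (simp add: r_def)
    show "ball q r \<subseteq> sumset (orbit v) ?d" if "q \<in> S" for q
    proof -
      have "r \<le> \<rho> q" using that S by (simp add: r_def)
      then show ?thesis using \<rho>(2)[OF that] subset_ball by blast
    qed
  qed
  \<comment> \<open>A bound on the rounding error that does not depend on \<open>n\<close>: the
    exact combination is 0, and rounding changes each coefficient by at most 1.\<close>
  define C where "C = (\<Sum>q\<in>S. norm q)"
  have "0 \<le> C" by (simp add: C_def sum_nonneg)
  obtain n :: nat where n: "C / r < n" using reals_Archimedean2 by blast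
  \<comment> \<open>Rounding up gives \<open>n \<le> N\<close>, as the coefficients sum to 1. With
    the choice of \<open>n\<close> this makes the radius \<open>N * r\<close> exceed
    \<open>C\<close>.\<close>
  define k where "k q = nat \<lceil>n * c q\<rceil>" for q
  define N where "N = (\<Sum>q\<in>S. k q)"
  have k: "n * c q \<le> k q" "k q \<le> n * c q + 1" if "q \<in> S" for q
  proof -
    have "0 \<le> n * c q" using c(1)[OF that] by simp
    then have "real (k q) = of_int \<lceil>n * c q\<rceil>" unfolding k_def by (simp add: of_nat_nat)
    then show "n * c q \<le> k q" "k q \<le> n * c q + 1" by linarith+
  qed
  have "real n = (\<Sum>q\<in>S. n * c q)" using c(2) by (simp flip: sum_distrib_left)
  also have "\<dots> \<le> N" using k(1) by (simp add: N_def sum_mono)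
  finally have nN: "n \<le> N" by simp
  have "0 \<le> C / r" using \<open>0 \<le> C\<close> r(1) by simp
  then have "0 < n" using n by (metis of_nat_0_less_iff order_le_less_trans)
  then have N: "0 < N" "C < N * r"
  proof -
    show "0 < N" using nN \<open>0 < n\<close> by simp
    have "C < n * r" using n r(1) by (simp add: field_simps)
    also have "\<dots> \<le> N * r" using nN r(1) by simp
    finally show "C < N * r" .
  qed
  define z where "z = (\<Sum>q\<in>S. real (k q) *\<^sub>R q)"
  have "norm z \<le> C"
  proof -
    have "(\<Sum>q\<in>S. (n * c q) *\<^sub>R q) = n *\<^sub>R (\<Sum>q\<in>S. c q *\<^sub>R q)"
      by (simp add: scaleR_right.sum)
    then have "z = (\<Sum>q\<in>S. (k q - n * c q) *\<^sub>R q)"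
      unfolding z_def by (simp add: scaleR_left_diff_distrib sum_subtractf c(3))
    also have "norm \<dots> \<le> (\<Sum>q\<in>S. norm q)"
      using k by (intro sum_norm_le) (auto intro!: mult_left_le_one_le simp: diff_le_eq add.commute)
    finally show ?thesis unfolding C_def .
  qed
  have "ball 0 (N * r - C) \<subseteq> sumset (orbit v) (N * ?d)"
  proof
    fix y :: 'v assume y: "y \<in> ball 0 (N * r - C)"
    \<comment> \<open>The displacement from \<open>z\<close> to \<open>y\<close> is shared equally
      among the \<open>N\<close> summands, so each of them moves by less than
      \<open>r\<close>.\<close>
    define w where "w = (1 / N) *\<^sub>R (y - z)"
    have "norm (y - z) < N * r"
      using y \<open>norm z \<le> C\<close> norm_triangle_ineq4[of y z] by simp
    then have w: "norm w < r" using N(1) unfolding w_def norm_scaleR by (simp add: field_simps)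
    have "y = z + real N *\<^sub>R w" using N(1) by (simp add: w_def)
    also have "real N *\<^sub>R w = (\<Sum>q\<in>S. real (k q) *\<^sub>R w)"
      by (simp add: N_def scaleR_left.sum)
    also have "z + \<dots> = (\<Sum>q\<in>S. real (k q) *\<^sub>R (q + w))"
      by (simp add: z_def sum.distrib scaleR_add_right)
    also have "\<dots> \<in> sumset (orbit v) (\<Sum>q\<in>S. k q * ?d)"
    proof (intro sumset_sum sumset_scaleR S(1))
      fix q assume "q \<in> S"
      have "dist q (q + w) < r"
        using w norm_minus_cancel[of w] by (simp add: dist_norm)
      then show "q + w \<in> sumset (orbit v) ?d"
        using r(2)[OF \<open>q \<in> S\<close>] by auto
    qed
    also have "(\<Sum>q\<in>S. k q * ?d) = N * ?d" by (simp add: N_def sum_distrib_right)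
    finally show "y \<in> sumset (orbit v) (N * ?d)" .
  qed
  moreover have "1 \<le> N * ?d" using N(1) DIM_positive[where 'a='v] by (simp add: Suc_le_eq)
  ultimately show ?thesis
    using N(2) by (meson diff_gt_0_iff_gt)
qed

end

section \<open>Symmetry of second derivatives\<close>

lemma has_derivative_frechet:
  "f differentiable (at x) \<Longrightarrow> (f has_derivative frechet_derivative f (at x)) (at x)"
  by (simp add: frechet_derivative_works)

lemma frechet_derivative_inner:
  assumes "f differentiable (at x)"
  shows "frechet_derivative (\<lambda>x. f x \<bullet> b) (at x) = (\<lambda>v. frechet_derivative f (at x) v \<bullet> b)"
  using assms has_derivative_inner_left[OF has_derivative_frechet] frechet_derivative_at by metis

lemma DERIV_along_line:
  fixes f :: "'a::real_normed_vector \<Rightarrow> real"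
  assumes "f differentiable (at (q + t *\<^sub>R u))"
  shows "((\<lambda>s. f (q + s *\<^sub>R u)) has_real_derivative frechet_derivative f (at (q + t *\<^sub>R u)) u) (at t)"
proof -
  have "((\<lambda>s. q + s *\<^sub>R u) has_derivative (\<lambda>s. s *\<^sub>R u)) (at t)"
    by (auto intro!: derivative_eq_intros)
  from has_derivative_compose[OF this has_derivative_frechet[OF assms]]
  show ?thesis
    unfolding has_field_derivative_def
    using linear_scale[OF linear_frechet_derivative[OF assms]] by (simp add: mult.commute[of _ "frechet_derivative f _ u"])
qed

text \<open>Two applications of the mean value theorem: in direction \<open>w\<close> to a
  difference of \<open>f\<close> along \<open>u\<close>, then in direction \<open>u\<close> to the
  derivative so obtained. The left side is symmetric in \<open>u\<close> and \<open>w\<close>, the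
  right side is not.\<close>

lemma second_difference_mean_value:
  fixes f :: "'a::euclidean_space \<Rightarrow> real"
  assumes f: "\<And>q. q \<in> S \<Longrightarrow> f differentiable (at q)"
    and f': "\<And>q. q \<in> S \<Longrightarrow> (\<lambda>q. frechet_derivative f (at q) w) differentiable (at q)"
    and s: "0 < s" "\<And>\<sigma> \<tau>. 0 \<le> \<sigma> \<Longrightarrow> \<sigma> \<le> s \<Longrightarrow> 0 \<le> \<tau> \<Longrightarrow> \<tau> \<le> s \<Longrightarrow> p + \<sigma> *\<^sub>R u + \<tau> *\<^sub>R w \<in> S"
  shows "\<exists>\<sigma> \<tau>. 0 \<le> \<sigma> \<and> \<sigma> \<le> s \<and> 0 \<le> \<tau> \<and> \<tau> \<le> s \<and>
    f (p + s *\<^sub>R u + s *\<^sub>R w) - f (p + s *\<^sub>R u) - f (p + s *\<^sub>R w) + f p =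
    s\<^sup>2 * frechet_derivative (\<lambda>q. frechet_derivative f (at q) w) (at (p + \<sigma> *\<^sub>R u + \<tau> *\<^sub>R w)) u"
proof -
  let ?g = "\<lambda>q. frechet_derivative f (at q) w"
  let ?F = "\<lambda>\<tau>. f ((p + s *\<^sub>R u) + \<tau> *\<^sub>R w) - f (p + \<tau> *\<^sub>R w)"
  have "\<exists>\<tau>. 0 < \<tau> \<and> \<tau> < s \<and> ?F s - ?F 0 = (s - 0) * (?g ((p + s *\<^sub>R u) + \<tau> *\<^sub>R w) - ?g (p + \<tau> *\<^sub>R w))"
  proof (rule MVT2[OF s(1)])
    fix \<tau> assume "0 \<le> \<tau>" "\<tau> \<le> s"
    then show "(?F has_real_derivative ?g ((p + s *\<^sub>R u) + \<tau> *\<^sub>R w) - ?g (p + \<tau> *\<^sub>R w)) (at \<tau>)"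
      using s(1) s(2)[of s \<tau>] s(2)[of 0 \<tau>] by (intro DERIV_diff DERIV_along_line f) auto
  qed
  then obtain \<tau> where \<tau>: "0 < \<tau>" "\<tau> < s"
    "?F s - ?F 0 = s * (?g ((p + s *\<^sub>R u) + \<tau> *\<^sub>R w) - ?g (p + \<tau> *\<^sub>R w))" by auto
  let ?H = "\<lambda>\<sigma>. ?g ((p + \<tau> *\<^sub>R w) + \<sigma> *\<^sub>R u)"
  have "\<exists>\<sigma>. 0 < \<sigma> \<and> \<sigma> < s \<and> ?H s - ?H 0 = (s - 0) * frechet_derivative ?g (at ((p + \<tau> *\<^sub>R w) + \<sigma> *\<^sub>R u)) u"
  proof (rule MVT2[OF s(1)])
    fix \<sigma> assume "0 \<le> \<sigma>" "\<sigma> \<le> s"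
    then show "(?H has_real_derivative frechet_derivative ?g (at ((p + \<tau> *\<^sub>R w) + \<sigma> *\<^sub>R u)) u) (at \<sigma>)"
      using \<tau> s(2)[of \<sigma> \<tau>] by (intro DERIV_along_line f') (simp add: add_ac)
  qed
  then obtain \<sigma> where \<sigma>: "0 < \<sigma>" "\<sigma> < s"
    "?H s - ?H 0 = s * frechet_derivative ?g (at ((p + \<tau> *\<^sub>R w) + \<sigma> *\<^sub>R u)) u" by auto
  have "?F s - ?F 0 = s\<^sup>2 * frechet_derivative ?g (at (p + \<sigma> *\<^sub>R u + \<tau> *\<^sub>R w)) u"
    using \<tau>(3) \<sigma>(3) by (simp add: power2_eq_square add_ac)
  then show ?thesis
    using \<sigma> \<tau> by (intro exI[of _ \<sigma>] exI[of _ \<tau>]) simp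
qed

text \<open>The same second difference is expressed by either mixed derivative at some point of a
  small parallelogram; continuity at \<open>p\<close> then forces the two values there to
  agree.\<close>

lemma mixed_partials_real:
  fixes f :: "'a::euclidean_space \<Rightarrow> real"
  assumes S: "open S" "p \<in> S"
    and f: "\<And>q. q \<in> S \<Longrightarrow> f differentiable (at q)"
    and f': "\<And>q w. q \<in> S \<Longrightarrow> (\<lambda>q. frechet_derivative f (at q) w) differentiable (at q)"
    and f'': "\<And>u w. continuous_on S (\<lambda>q. frechet_derivative (\<lambda>q. frechet_derivative f (at q) w) (at q) u)"
  shows "frechet_derivative (\<lambda>q. frechet_derivative f (at q) w) (at p) u =
         frechet_derivative (\<lambda>q. frechet_derivative f (at q) u) (at p) w"
proof (rule ccontr)
  let ?D = "\<lambda>u w q. frechet_derivative (\<lambda>q. frechet_derivative f (at q) w) (at q) u"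
  assume ne: "?D u w p \<noteq> ?D w u p"
  \<comment> \<open>Half the gap: two deviations below \<open>\<epsilon>\<close> cannot bridge
    it.\<close>
  define \<epsilon> where "\<epsilon> = \<bar>?D u w p - ?D w u p\<bar> / 2"
  have \<epsilon>: "0 < \<epsilon>" using ne by (simp add: \<epsilon>_def)
  have near: "\<exists>d>0. \<forall>q. dist q p < d \<longrightarrow> q \<in> S \<and> \<bar>?D u w q - ?D u w p\<bar> < \<epsilon>" for u w
  proof -
    have "isCont (?D u w) p"
      using f'' S continuous_on_eq_continuous_at by blast
    then obtain d where "0 < d" "\<forall>q. dist q p < d \<longrightarrow> dist (?D u w q) (?D u w p) < \<epsilon>"
      using \<epsilon> unfolding continuous_at_eps_delta by blast
    moreover obtain d' where "0 < d'" "\<forall>q. dist q p < d' \<longrightarrow> q \<in> S"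
      using S unfolding open_dist by blast
    ultimately show ?thesis
      by (intro exI[of _ "min d d'"]) (auto simp: dist_real_def)
  qed
  obtain d where d: "0 < d" "\<And>q. dist q p < d \<Longrightarrow> q \<in> S \<and> \<bar>?D u w q - ?D u w p\<bar> < \<epsilon>"
    using near by blast
  obtain e where e: "0 < e" "\<And>q. dist q p < e \<Longrightarrow> q \<in> S \<and> \<bar>?D w u q - ?D w u p\<bar> < \<epsilon>"
    using near by blast
  \<comment> \<open>The parallelogram with sides \<open>s *\<^sub>R u\<close> and
    \<open>s *\<^sub>R w\<close> stays within half of the smaller radius; the summand 1 keeps the
    denominator positive when both vectors vanish.\<close>
  define s where "s = min d e / (2 * (1 + norm u + norm w))"
  have pos: "0 < 1 + norm u + norm w" by (simp add: add_pos_nonneg)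
  have s: "0 < s" using d e pos by (simp add: s_def)
  have close: "dist (p + \<sigma> *\<^sub>R u + \<tau> *\<^sub>R w) p < min d e"
    if "0 \<le> \<sigma>" "\<sigma> \<le> s" "0 \<le> \<tau>" "\<tau> \<le> s" for \<sigma> \<tau>
  proof -
    have "dist (p + \<sigma> *\<^sub>R u + \<tau> *\<^sub>R w) p = norm (\<sigma> *\<^sub>R u + \<tau> *\<^sub>R w)"
      by (simp add: dist_norm algebra_simps)
    also have "\<dots> \<le> \<sigma> * norm u + \<tau> * norm w"
      using norm_triangle_ineq[of "\<sigma> *\<^sub>R u" "\<tau> *\<^sub>R w"] that by simp
    also have "\<dots> \<le> s * norm u + s * norm w"
      using that by (intro add_mono mult_right_mono) auto
    also have "\<dots> \<le> s * (1 + norm u + norm w)"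
      using s by (simp add: algebra_simps)
    also have "\<dots> = min d e / 2"
      using pos unfolding s_def by (simp add: divide_simps del: distrib_right_numeral distrib_left_numeral)
    also have "\<dots> < min d e" using d(1) e(1) by linarith
    finally show ?thesis .
  qed
  let ?\<Delta> = "f (p + s *\<^sub>R u + s *\<^sub>R w) - f (p + s *\<^sub>R u) - f (p + s *\<^sub>R w) + f p"
  obtain \<sigma> \<tau> where 1: "0 \<le> \<sigma>" "\<sigma> \<le> s" "0 \<le> \<tau>" "\<tau> \<le> s" "?\<Delta> = s\<^sup>2 * ?D u w (p + \<sigma> *\<^sub>R u + \<tau> *\<^sub>R w)"
    using second_difference_mean_value[of S f w s p u, OF f f' s] close d(2) by force
  have "p + \<sigma> *\<^sub>R w + \<tau> *\<^sub>R u \<in> S" if "0 \<le> \<sigma>" "\<sigma> \<le> s" "0 \<le> \<tau>" "\<tau> \<le> s" for \<sigma> \<tau>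
    using close[of \<tau> \<sigma>] that d(2) by (simp add: add_ac)
  then obtain \<sigma>' \<tau>' where 2: "0 \<le> \<sigma>'" "\<sigma>' \<le> s" "0 \<le> \<tau>'" "\<tau>' \<le> s" 
    "f (p + s *\<^sub>R w + s *\<^sub>R u) - f (p + s *\<^sub>R w) - f (p + s *\<^sub>R u) + f p = s\<^sup>2 * ?D w u (p + \<sigma>' *\<^sub>R w + \<tau>' *\<^sub>R u)"
    using second_difference_mean_value[of S f u s p w, OF f f' s] by blast
  have swap: "p + x + y = p + y + x" for x y :: 'a
    by (simp add: add_ac)
  have "s\<^sup>2 * ?D u w (p + \<sigma> *\<^sub>R u + \<tau> *\<^sub>R w) = s\<^sup>2 * ?D w u (p + \<tau>' *\<^sub>R u + \<sigma>' *\<^sub>R w)"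
    using 1(5) 2(5) unfolding swap[of "_ *\<^sub>R w" "_ *\<^sub>R u"] by linarith
  then have "?D u w (p + \<sigma> *\<^sub>R u + \<tau> *\<^sub>R w) = ?D w u (p + \<tau>' *\<^sub>R u + \<sigma>' *\<^sub>R w)"
    using s by simp
  moreover have "\<bar>?D u w (p + \<sigma> *\<^sub>R u + \<tau> *\<^sub>R w) - ?D u w p\<bar> < \<epsilon>"
    using d(2) close[OF 1(1-4)] by simp
  moreover have "\<bar>?D w u (p + \<tau>' *\<^sub>R u + \<sigma>' *\<^sub>R w) - ?D w u p\<bar> < \<epsilon>"
    using e(2) close[OF 2(3,4,1,2)] by simp
  ultimately have "\<bar>?D u w p - ?D w u p\<bar> < 2 * \<epsilon>"
    unfolding abs_less_iff by linarith
  then show False by (simp add: \<epsilon>_def)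
qed

text \<open>Taken coordinate by coordinate, since the mean value argument needs real values.\<close>

lemma mixed_partials:
  fixes f :: "'a::euclidean_space \<Rightarrow> 'b::euclidean_space"
  assumes f: "Ck_on 2 S f" and S: "open S" "p \<in> S"
  shows "frechet_derivative (\<lambda>q. frechet_derivative f (at q) w) (at p) u =
         frechet_derivative (\<lambda>q. frechet_derivative f (at q) u) (at p) w"
proof (rule euclidean_eqI)
  fix b :: 'b
  assume "b \<in> Basis"
  let ?h = "\<lambda>x. f x \<bullet> b"
  have d: "f differentiable (at q)" "(\<lambda>q. frechet_derivative f (at q) w) differentiable (at q)"
    "continuous_on S (\<lambda>q. frechet_derivative (\<lambda>q. frechet_derivative f (at q) w) (at q) u)"
    if "q \<in> S" for q u w
    using f that by (auto simp: numeral_2_eq_2)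
  have h': "frechet_derivative ?h (at q) w = frechet_derivative f (at q) w \<bullet> b" if "q \<in> S" for q w
    using frechet_derivative_inner[OF d(1)[OF that]] by simp
  \<comment> \<open>The coordinate formula for the first derivative holds only on \<open>S\<close>;
    openness of \<open>S\<close> allows it to be differentiated again.\<close>
  have cong: "frechet_derivative F (at q) = frechet_derivative K (at q)"
    if "q \<in> S" "K differentiable (at q)" "\<And>q. q \<in> S \<Longrightarrow> F q = K q" for q and F K :: "'a \<Rightarrow> real"
    using has_derivative_transform_within_open[OF has_derivative_frechet[OF that(2)] S(1) that(1), of F] that(3)
    by (metis frechet_derivative_at)
  have dinner: "(\<lambda>q. frechet_derivative f (at q) w \<bullet> b) differentiable (at q)" if "q \<in> S" for q w
    using has_derivative_inner_left[OF has_derivative_frechet[OF d(2)[OF that]]] differentiable_def by blast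
  have h'': "frechet_derivative (\<lambda>q. frechet_derivative ?h (at q) w) (at q) u =
      frechet_derivative (\<lambda>q. frechet_derivative f (at q) w) (at q) u \<bullet> b" if "q \<in> S" for q u w
    using cong[OF that dinner[OF that], of "\<lambda>q. frechet_derivative ?h (at q) w"] h'
      frechet_derivative_inner[OF d(2)[OF that]] by simp
  have "frechet_derivative (\<lambda>q. frechet_derivative ?h (at q) w) (at p) u =
         frechet_derivative (\<lambda>q. frechet_derivative ?h (at q) u) (at p) w"
  proof (rule mixed_partials_real[OF S])
    show "?h differentiable (at q)" if "q \<in> S" for q
      using has_derivative_inner_left[OF has_derivative_frechet[OF d(1)[OF that]]] differentiable_def by blast
    show "(\<lambda>q. frechet_derivative ?h (at q) w) differentiable (at q)" if q: "q \<in> S" for q w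
    proof -
      have "((\<lambda>q. frechet_derivative f (at q) w \<bullet> b) has_derivative
          (\<lambda>u. frechet_derivative (\<lambda>q. frechet_derivative f (at q) w) (at q) u \<bullet> b)) (at q)"
        using has_derivative_inner_left[OF has_derivative_frechet[OF d(2)[OF q]]] .
      from has_derivative_transform_within_open[OF this S(1) q h'[symmetric]] show ?thesis
        unfolding differentiable_def by blast
    qed
    show "continuous_on S (\<lambda>q. frechet_derivative (\<lambda>q. frechet_derivative ?h (at q) w) (at q) u)" for u w
      using continuous_on_inner[OF d(3)[OF S(2), of w u] continuous_on_const[of S b]]
      by (rule continuous_on_eq) (simp add: h'')
  qed
  then show "frechet_derivative (\<lambda>q. frechet_derivative f (at q) w) (at p) u \<bullet> b =
         frechet_derivative (\<lambda>q. frechet_derivative f (at q) u) (at p) w \<bullet> b"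
    using h'' S(2) by simp
qed

section \<open>Charts and tangent spaces\<close>

text \<open>A product rule in which one factor is merely continuous: its increment is multiplied by
  \<open>h y\<close>, which is already of first order because \<open>h\<close> vanishes at
  \<open>x\<close>.\<close>

lemma has_derivative_scaleR_vanishing:
  fixes h :: "'a::real_normed_vector \<Rightarrow> 'b::real_normed_vector"
  assumes f: "isCont f x" and h: "(h has_derivative h') (at x)" "h x = 0"
  shows "((\<lambda>y. f y *\<^sub>R h y) has_derivative (\<lambda>v. f x *\<^sub>R h' v)) (at x)"
  unfolding has_derivative_at_alt
proof (intro conjI allI impI)
  have h': "bounded_linear h'" using h(1) by (rule has_derivative_bounded_linear)
  then show "bounded_linear (\<lambda>v. f x *\<^sub>R h' v)"
    by (rule bounded_linear_const_scaleR)
  fix e :: real assume e: "0 < e"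
  obtain K where K: "0 < K" "\<And>v. norm (h' v) \<le> norm v * K"
    using bounded_linear.pos_bounded[OF h'] by blast
  \<comment> \<open>The two error terms are \<open>a * (1 + K)\<close> and
    \<open>(1 + \<bar>f x\<bar>) * b\<close> times the distance; each is to be half of
    \<open>e\<close>.\<close>
  define a where "a = e / 2 / (1 + K)"
  define b where "b = e / 2 / (1 + \<bar>f x\<bar>)"
  have ab: "0 < a" "0 < b" using e K by (simp_all add: a_def b_def add_pos_nonneg)
  obtain d1 where d1: "0 < d1" "\<And>y. norm (y - x) < d1 \<Longrightarrow> norm (h y - h x - h' (y - x)) \<le> min 1 b * norm (y - x)"
    using h(1)[unfolded has_derivative_at_alt, THEN conjunct2, rule_format, of "min 1 b"] ab(2) by auto
  obtain d2 where d2: "0 < d2" "\<And>y. norm (y - x) < d2 \<Longrightarrow> \<bar>f y - f x\<bar> < a"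
    using f[unfolded continuous_at_eps_delta, rule_format, OF ab(1)] by (auto simp: dist_norm)
  show "\<exists>d>0. \<forall>y. norm (y - x) < d \<longrightarrow>
      norm (f y *\<^sub>R h y - f x *\<^sub>R h x - f x *\<^sub>R h' (y - x)) \<le> e * norm (y - x)"
  proof (intro exI[of _ "min d1 d2"] conjI allI impI)
    show "0 < min d1 d2" using d1 d2 by simp
    fix y assume y: "norm (y - x) < min d1 d2"
    let ?r = "h y - h x - h' (y - x)"
    have r: "norm ?r \<le> min 1 b * norm (y - x)" using d1(2) y by simp
    have "min 1 b * norm (y - x) \<le> 1 * norm (y - x)" "min 1 b * norm (y - x) \<le> b * norm (y - x)"
      by (intro mult_right_mono; simp)+
    with r have r1: "norm ?r \<le> norm (y - x)" and rb: "norm ?r \<le> b * norm (y - x)" by simp_all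
    have "norm (h y) \<le> norm ?r + norm (h' (y - x))"
      using norm_triangle_ineq[of ?r "h' (y - x)"] h(2) by simp
    also have "\<dots> \<le> (1 + K) * norm (y - x)"
      using r1 K(2)[of "y - x"] by (simp add: algebra_simps)
    finally have hy: "norm (h y) \<le> (1 + K) * norm (y - x)" .
    have "norm (f y *\<^sub>R h y - f x *\<^sub>R h x - f x *\<^sub>R h' (y - x)) = norm ((f y - f x) *\<^sub>R h y + f x *\<^sub>R ?r)"
      by (simp add: h(2) algebra_simps)
    also have "\<dots> \<le> \<bar>f y - f x\<bar> * norm (h y) + \<bar>f x\<bar> * norm ?r"
      by (rule norm_triangle_le) simp
    also have "\<dots> \<le> a * ((1 + K) * norm (y - x)) + (1 + \<bar>f x\<bar>) * (b * norm (y - x))"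
      using d2(2)[of y] y hy rb ab K(1) by (intro add_mono mult_mono) auto
    also have "\<dots> = (a * (1 + K) + (1 + \<bar>f x\<bar>) * b) * norm (y - x)"
      by (simp only: distrib_right mult.assoc)
    also have "a * (1 + K) = e / 2" 
      using K(1) a_def by (subst (asm) nonzero_eq_divide_eq) simp_all
    also have "(1 + \<bar>f x\<bar>) * b = e / 2"
      using b_def by (subst (asm) nonzero_eq_divide_eq) (simp_all add: mult.commute)
    finally show "norm (f y *\<^sub>R h y - f x *\<^sub>R h x - f x *\<^sub>R h' (y - x)) \<le> e * norm (y - x)" by simp
  qed
qed

lemma linear_euclidean_expansion:
  fixes f :: "'a::euclidean_space \<Rightarrow> 'b::real_vector"
  assumes "linear f"
  shows "f w = (\<Sum>b\<in>Basis. (w \<bullet> b) *\<^sub>R f b)"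
proof -
  have "f w = f (\<Sum>b\<in>Basis. (w \<bullet> b) *\<^sub>R b)"
    by (simp only: euclidean_representation)
  also have "\<dots> = (\<Sum>b\<in>Basis. (w \<bullet> b) *\<^sub>R f b)"
    by (simp only: linear_sum[OF assms] linear_scale[OF assms])
  finally show ?thesis .
qed

text \<open>Implicit differentiation of \<open>R x (y x) = l x\<close> without prior regularity of
  \<open>y\<close>. As \<open>R x0\<close> is the identity, \<open>y\<close> equals \<open>l\<close>
  minus terms whose factors \<open>R x b - b\<close> vanish at \<open>x0\<close>; continuity of
  \<open>y\<close> there is then enough for differentiability.\<close>

lemma has_derivative_linear_solution:
  fixes y l :: "'a::real_normed_vector \<Rightarrow> 'b::euclidean_space" and R :: "'a \<Rightarrow> 'b \<Rightarrow> 'b"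
  assumes S: "open S" "x0 \<in> S"
    and lin: "\<And>x. x \<in> S \<Longrightarrow> linear (R x)"
    and eq: "\<And>x. x \<in> S \<Longrightarrow> R x (y x) = l x"
    and R0: "\<And>w. R x0 w = w"
    and l: "(l has_derivative l') (at x0)"
    and R: "\<And>w. ((\<lambda>x. R x w) has_derivative R' w) (at x0)"
  shows "(y has_derivative (\<lambda>v. l' v - R' (y x0) v)) (at x0)"
proof -
  have y_eq: "y x = l x - (\<Sum>b\<in>Basis. (y x \<bullet> b) *\<^sub>R (R x b - b))" if "x \<in> S" for x
    using linear_euclidean_expansion[OF lin[OF that], of "y x"] eq[OF that]
    by (simp add: scaleR_diff_right sum_subtractf euclidean_representation)
  have Rb: "((\<lambda>x. R x b - b) has_derivative R' b) (at x0)" for b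
    using has_derivative_diff[OF R[of b] has_derivative_const[of b]] by simp
  \<comment> \<open>Measures how far \<open>R x\<close> is from the identity. Once it is below 1,
    the unknown increment of \<open>y\<close> is absorbed into the left side of its own estimate,
    which yields continuity at \<open>x0\<close>.\<close>
  define \<delta> where "\<delta> x = (\<Sum>b\<in>Basis. norm (R x b - b))" for x
  have \<delta>: "(\<delta> \<longlongrightarrow> 0) (at x0)"
  proof -
    have "isCont (\<lambda>x. R x b - b) x0" for b
      using has_derivative_continuous[OF Rb] .
    then have "((\<lambda>x. R x b - b) \<longlongrightarrow> 0) (at x0)" for b
      using R0 by (metis (no_types, lifting) cancel_comm_monoid_add_class.diff_cancel isCont_def)
    then show ?thesis
      unfolding \<delta>_def by (intro tendsto_null_sum tendsto_norm_zero)
  qed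
  have ev: "eventually (\<lambda>x. x \<in> S) (at x0)"
    using S eventually_at_in_open' by blast
  have y0: "y x0 = l x0" using eq[OF S(2)] R0 by simp
  have "((\<lambda>x. (norm (l x - l x0) + norm (y x0) * \<delta> x) / (1 - \<delta> x)) \<longlongrightarrow> (0 + norm (y x0) * 0) / (1 - 0)) (at x0)"
    using has_derivative_continuous[OF l] unfolding isCont_def
    by (intro tendsto_intros \<delta> tendsto_norm_zero LIM_zero) auto
  then have lim: "((\<lambda>x. (norm (l x - l x0) + norm (y x0) * \<delta> x) / (1 - \<delta> x)) \<longlongrightarrow> 0) (at x0)"
    by simp
  have "eventually (\<lambda>x. norm (y x - y x0) \<le> (norm (l x - l x0) + norm (y x0) * \<delta> x) / (1 - \<delta> x)) (at x0)"
    using ev order_tendstoD(2)[OF \<delta> zero_less_one]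
  proof eventually_elim
    case (elim x)
    have "norm (\<Sum>b\<in>Basis. (y x \<bullet> b) *\<^sub>R (R x b - b)) \<le> (\<Sum>b\<in>Basis. norm (y x) * norm (R x b - b))"
      by (intro sum_norm_le) (simp add: Basis_le_norm mult_right_mono)
    also have "\<dots> = norm (y x) * \<delta> x"
      by (simp add: \<delta>_def sum_distrib_left)
    also have "\<dots> \<le> (norm (y x - y x0) + norm (y x0)) * \<delta> x"
      using norm_triangle_sub[of "y x" "y x0"] by (intro mult_right_mono) (simp_all add: \<delta>_def sum_nonneg add.commute)
    finally have s: "norm (\<Sum>b\<in>Basis. (y x \<bullet> b) *\<^sub>R (R x b - b)) \<le> (norm (y x - y x0) + norm (y x0)) * \<delta> x" .
    have "norm (y x - y x0) = norm ((l x - l x0) - (\<Sum>b\<in>Basis. (y x \<bullet> b) *\<^sub>R (R x b - b)))"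
      unfolding y0[symmetric] by (subst y_eq[OF elim(1)]) (simp add: algebra_simps)
    also have "\<dots> \<le> norm (l x - l x0) + (norm (y x - y x0) + norm (y x0)) * \<delta> x"
      using s norm_triangle_ineq4[of "l x - l x0" "\<Sum>b\<in>Basis. (y x \<bullet> b) *\<^sub>R (R x b - b)"] by linarith
    finally show ?case
      using elim(2) by (simp add: pos_le_divide_eq algebra_simps)
  qed
  then have "((\<lambda>x. y x - y x0) \<longlongrightarrow> 0) (at x0)"
    by (rule Lim_null_comparison[OF _ lim])
  then have cont: "isCont y x0"
    by (simp add: isCont_def LIM_zero_iff)
  have "((\<lambda>x. l x - (\<Sum>b\<in>Basis. (y x \<bullet> b) *\<^sub>R (R x b - b))) has_derivative
      (\<lambda>v. l' v - (\<Sum>b\<in>Basis. (y x0 \<bullet> b) *\<^sub>R R' b v))) (at x0)"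
    using cont by (intro has_derivative_diff l has_derivative_sum has_derivative_scaleR_vanishing Rb)
      (auto intro!: continuous_inner simp: R0)
  then have der: "(y has_derivative (\<lambda>v. l' v - (\<Sum>b\<in>Basis. (y x0 \<bullet> b) *\<^sub>R R' b v))) (at x0)"
    using has_derivative_transform_within_open[OF _ S] y_eq by (metis (no_types, lifting))
  \<comment> \<open>Linearity of \<open>R'\<close> in its first argument is not given; it is read
    off from that of \<open>R x\<close> by uniqueness of the derivative.\<close>
  have "((\<lambda>x. \<Sum>b\<in>Basis. (y x0 \<bullet> b) *\<^sub>R R x b) has_derivative
      (\<lambda>v. \<Sum>b\<in>Basis. (y x0 \<bullet> b) *\<^sub>R R' b v)) (at x0)"
    using R by (intro has_derivative_sum has_derivative_scaleR_right)
  then have "((\<lambda>x. R x (y x0)) has_derivative (\<lambda>v. \<Sum>b\<in>Basis. (y x0 \<bullet> b) *\<^sub>R R' b v)) (at x0)"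
    by (rule has_derivative_transform_within_open[OF _ S]) (simp add: linear_euclidean_expansion[OF lin])
  then have "R' (y x0) = (\<lambda>v. \<Sum>b\<in>Basis. (y x0 \<bullet> b) *\<^sub>R R' b v)"
    using R has_derivative_unique by blast
  then show ?thesis using der by simp
qed

section \<open>Differentiation in charts and tangent vectors\<close>

context smooth_manifold
begin

lemma openin_chart: "c \<in> A \<Longrightarrow> openin M (fst c)"
  using charts[of c] unfolding is_chart_def by blast

lemma chart_subset: "c \<in> A \<Longrightarrow> fst c \<subseteq> topspace M"
  using openin_chart by (rule openin_subset)

lemma ex_chart: "p \<in> topspace M \<Longrightarrow> \<exists>c\<in>A. p \<in> fst c"
  using cover by blast

lemma inj_on_chart: "c \<in> A \<Longrightarrow> inj_on (snd c) (fst c)"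
proof -
  assume c: "c \<in> A"
  then have "inj_on (snd c) (topspace (subtopology M (fst c)))"
    using charts[OF c] unfolding is_chart_def homeomorphic_map_def by blast
  also have "topspace (subtopology M (fst c)) = fst c"
    using chart_subset[OF c] by (simp add: inf.absorb2)
  finally show ?thesis .
qed

lemma chart_inv_chart: "c \<in> A \<Longrightarrow> p \<in> fst c \<Longrightarrow> chart_inv c (snd c p) = p"
  using inj_on_chart by (intro inv_into_f_f)

lemma open_chart_image:
  assumes "c \<in> A" "openin M S" "S \<subseteq> fst c"
  shows "open (snd c ` S)"
proof -
  obtain V where V: "open V" "homeomorphic_map (subtopology M (fst c)) (top_of_set V) (snd c)"
    using charts[OF assms(1)] by (auto simp: is_chart_def)
  have "openin (subtopology M (fst c)) S"
    using assms openin_chart openin_open_subtopology by blast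
  then have "openin (top_of_set V) (snd c ` S)"
    using homeomorphic_imp_open_map[OF V(2)] open_map_def by blast
  then show ?thesis using V(1) openin_open_trans by blast
qed

lemma openin_chart_preimage:
  assumes "c \<in> A" "open T"
  shows "openin M {p \<in> fst c. snd c p \<in> T}"
proof -
  obtain V where V: "homeomorphic_map (subtopology M (fst c)) (top_of_set V) (snd c)"
    using charts[OF assms(1)] by (auto simp: is_chart_def)
  have "openin (top_of_set V) (V \<inter> T)" using assms(2) by blast
  then have "openin (subtopology M (fst c)) {p \<in> topspace (subtopology M (fst c)). snd c p \<in> V \<inter> T}"
    using homeomorphic_imp_continuous_map[OF V] openin_continuous_map_preimage by blast
  then have "openin M {p \<in> topspace (subtopology M (fst c)). snd c p \<in> V \<inter> T}"
    using openin_trans_full openin_chart[OF assms(1)] by blast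
  also have "{p \<in> topspace (subtopology M (fst c)). snd c p \<in> V \<inter> T} = {p \<in> fst c. snd c p \<in> T}"
    using homeomorphic_imp_surjective_map[OF V] chart_subset[OF assms(1)] by auto
  finally show ?thesis .
qed

lemma continuous_map_chart_inv:
  assumes c: "c \<in> A"
  shows "continuous_map (top_of_set (snd c ` fst c)) M (chart_inv c)"
  unfolding continuous_map_def
proof (intro conjI allI impI)
  show "chart_inv c \<in> topspace (top_of_set (snd c ` fst c)) \<rightarrow> topspace M"
    using chart_inv_chart[OF c] chart_subset[OF c] by auto
  fix U assume U: "openin M U"
  have "{x \<in> topspace (top_of_set (snd c ` fst c)). chart_inv c x \<in> U} = snd c ` (fst c \<inter> U)"
    using chart_inv_chart[OF c] by auto
  moreover have "open (snd c ` (fst c \<inter> U))"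
    using U by (intro open_chart_image[OF c]) (auto intro: openin_Int openin_chart[OF c])
  ultimately show "openin (top_of_set (snd c ` fst c)) {x \<in> topspace (top_of_set (snd c ` fst c)). chart_inv c x \<in> U}"
    by (auto intro!: open_subset)
qed

lemma local_rep_chart: "c \<in> A \<Longrightarrow> p \<in> fst c \<Longrightarrow> local_rep c d F (snd c p) = snd d (F p)"
  by (simp add: local_rep_def chart_inv_chart)

text \<open>The points that \<open>F\<close> sends into \<open>d\<close> form an open set, on which
  the inverse of \<open>d\<close> cancels. The separate \<open>K\<close> admits identities that hold
  only on the manifold, such as the group laws.\<close>

lemma local_rep_chain:
  assumes c: "c \<in> A" "p \<in> fst c" and d: "d \<in> A" "F p \<in> fst d"
    and F: "continuous_map M M F" "(local_rep c d F has_derivative D) (at (snd c p))"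
    and H: "(local_rep d e H has_derivative D') (at (snd d (F p)))"
    and K: "\<And>q. q \<in> topspace M \<Longrightarrow> K q = H (F q)"
  shows "(local_rep c e K has_derivative (\<lambda>v. D' (D v))) (at (snd c p))"
proof -
  let ?S = "fst c \<inter> {q \<in> topspace M. F q \<in> fst d}"
  have S: "openin M ?S"
    using openin_continuous_map_preimage[OF F(1) openin_chart[OF d(1)]] openin_chart[OF c(1)] by blast
  have p: "p \<in> ?S" using c d chart_subset by blast
  have "((\<lambda>x. local_rep d e H (local_rep c d F x)) has_derivative (\<lambda>v. D' (D v))) (at (snd c p))"
    by (rule has_derivative_compose[OF F(2)]) (simp add: local_rep_chart[OF c] H)
  then show ?thesis
  proof (rule has_derivative_transform_within_open)
    show "open (snd c ` ?S)" by (rule open_chart_image[OF c(1) S]) blast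
    show "snd c p \<in> snd c ` ?S" using p by blast
    show "local_rep d e H (local_rep c d F x) = local_rep c e K x" if "x \<in> snd c ` ?S" for x
      using that K by (auto simp: local_rep_chart[OF c(1)] local_rep_chart[OF d(1)])
  qed
qed

lemma local_rep_id_has_derivative:
  assumes "c \<in> A" "d \<in> A" "p \<in> fst c" "p \<in> fst d"
  shows "(local_rep c d (\<lambda>p. p) has_derivative frechet_derivative (local_rep c d (\<lambda>p. p)) (at (snd c p))) (at (snd c p))"
proof -
  have "Ck_on 1 (snd c ` (fst c \<inter> fst d)) (local_rep c d (\<lambda>p. p))"
    using compatible[OF assms(1,2)] smooth_on_def by blast
  then show ?thesis
    using assms by (intro has_derivative_frechet) auto
qed

lemma local_rep_chart_change:
  assumes "c \<in> A" "p \<in> fst c" "d \<in> A" "p \<in> fst d"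
    and "(local_rep d e H has_derivative D) (at (snd d p))"
  shows "(local_rep c e H has_derivative
    (\<lambda>v. D (frechet_derivative (local_rep c d (\<lambda>q. q)) (at (snd c p)) v))) (at (snd c p))"
  by (rule local_rep_chain[where F = "\<lambda>q. q" and H = H, OF assms(1-4) _
        local_rep_id_has_derivative[OF assms(1,3,2,4)] assms(5)]) simp_all

lemma local_rep_id_same:
  assumes "c \<in> A" "p \<in> fst c"
  shows "(local_rep c c (\<lambda>p. p) has_derivative (\<lambda>v. v)) (at (snd c p))"
proof (rule has_derivative_transform_within_open[OF has_derivative_ident])
  show "open (snd c ` fst c)"
    by (rule open_chart_image[OF assms(1) openin_chart[OF assms(1)] order_refl])
  show "snd c p \<in> snd c ` fst c" using assms(2) by (rule imageI)
  show "x = local_rep c c (\<lambda>p. p) x" if "x \<in> snd c ` fst c" for x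
    using that local_rep_chart[OF assms(1), of _ c "\<lambda>p. p"] by auto
qed

lemma tangent_spaceI:
  assumes "\<And>c. \<not> (c \<in> A \<and> p \<in> fst c) \<Longrightarrow> v c = 0"
    and "\<And>c d. c \<in> A \<Longrightarrow> p \<in> fst c \<Longrightarrow> d \<in> A \<Longrightarrow> p \<in> fst d \<Longrightarrow>
      v d = frechet_derivative (local_rep c d (\<lambda>q. q)) (at (snd c p)) (v c)"
  shows "v \<in> tangent_space A p"
  unfolding tangent_space_def mem_Collect_eq
  by (intro conjI allI ballI impI; (elim conjE)?; rule assms; assumption)

lemma tangent_space_outside:
  "v \<in> tangent_space A p \<Longrightarrow> \<not> (c \<in> A \<and> p \<in> fst c) \<Longrightarrow> v c = 0"
  unfolding tangent_space_def by blast

lemma tangent_space_change: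
  assumes "v \<in> tangent_space A p" "c \<in> A" "p \<in> fst c" "d \<in> A" "p \<in> fst d"
  shows "frechet_derivative (local_rep c d (\<lambda>q. q)) (at (snd c p)) (v c) = v d"
proof -
  have "\<forall>c\<in>A. \<forall>d\<in>A. p \<in> fst c \<and> p \<in> fst d \<longrightarrow>
      v d = frechet_derivative (local_rep c d (\<lambda>q. q)) (at (snd c p)) (v c)"
    using assms(1) unfolding tangent_space_def mem_Collect_eq by (rule conjunct2)
  from this[rule_format, OF assms(2,4) conjI[OF assms(3,5)]] show ?thesis
    by (rule sym)
qed

text \<open>The inverse of evaluation at the chart \<open>c\<close>, turning coordinate vectors into
  tangent vectors.\<close>

definition tangent_lift :: "'p \<Rightarrow> ('p, 'e) chart \<Rightarrow> 'e \<Rightarrow> ('p, 'e) chart \<Rightarrow> 'e" where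
  "tangent_lift p c w = (\<lambda>d. if d \<in> A \<and> p \<in> fst d
     then frechet_derivative (local_rep c d (\<lambda>q. q)) (at (snd c p)) w else 0)"

lemma tangent_lift_chart:
  assumes "c \<in> A" "p \<in> fst c"
  shows "tangent_lift p c w c = w"
proof -
  have "frechet_derivative (local_rep c c (\<lambda>p. p)) (at (snd c p)) w = w"
    using frechet_derivative_at[OF local_rep_id_same[OF assms], THEN fun_cong, of w] by (rule sym)
  then show ?thesis
    using assms by (simp add: tangent_lift_def)
qed

text \<open>The compatibility condition is the cocycle rule for derivatives of transition maps, an
  instance of the chain rule.\<close>

lemma tangent_lift_in_tangent_space:
  assumes c: "c \<in> A" "p \<in> fst c"
  shows "tangent_lift p c w \<in> tangent_space A p"
proof -
  have change: "tangent_lift p c w e = frechet_derivative (local_rep d e (\<lambda>q. q)) (at (snd d p)) (tangent_lift p c w d)"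
    if d: "d \<in> A" "p \<in> fst d" and e: "e \<in> A" "p \<in> fst e" for d e
  proof -
    have "(local_rep c e (\<lambda>q. q) has_derivative (\<lambda>v. frechet_derivative (local_rep d e (\<lambda>q. q)) (at (snd d p))
        (frechet_derivative (local_rep c d (\<lambda>q. q)) (at (snd c p)) v))) (at (snd c p))"
      by (rule local_rep_chart_change[OF c d local_rep_id_has_derivative]) (use d e in auto)
    from frechet_derivative_at[OF this, THEN fun_cong, of w] show ?thesis
      using d e by (simp add: tangent_lift_def)
  qed
  show ?thesis
  proof (rule tangent_spaceI)
    show "tangent_lift p c w d = 0" if "\<not> (d \<in> A \<and> p \<in> fst d)" for d
      unfolding tangent_lift_def using that by (rule if_not_P)
  qed (rule change)
qed

lemma tangent_lift_eval:
  assumes "c \<in> A" "p \<in> fst c" "v \<in> tangent_space A p"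
  shows "tangent_lift p c (v c) = v"
proof
  fix d
  show "tangent_lift p c (v c) d = v d"
    using tangent_space_change[OF assms(3,1,2)] tangent_space_outside[OF assms(3)]
    by (auto simp: tangent_lift_def)
qed

text \<open>Evaluation at one chart is injective, so identities between tangent vectors can be
  checked in a single chart.\<close>

lemma tangent_space_eqI:
  assumes "c \<in> A" "p \<in> fst c" "v \<in> tangent_space A p" "w \<in> tangent_space A p" "v c = w c"
  shows "v = w"
  using tangent_lift_eval[OF assms(1,2,3)] tangent_lift_eval[OF assms(1,2,4)]
  unfolding assms(5) by (rule trans[OF sym])

text \<open>Replaces the arbitrarily chosen source chart by any convenient one.\<close>

lemma differential_chart:
  assumes v: "v \<in> tangent_space A p" and c: "c \<in> A" "p \<in> fst c" and d: "d \<in> A" "F p \<in> fst d"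
    and F: "(local_rep c d F has_derivative D) (at (snd c p))"
  shows "differential A A F p v d = D (v c)"
proof -
  define b where "b = (SOME c. c \<in> A \<and> p \<in> fst c)"
  have "b \<in> A \<and> p \<in> fst b"
    unfolding b_def by (rule someI[of _ c]) (use c in simp)
  then have b: "b \<in> A" "p \<in> fst b" by simp_all
  have "(local_rep b d F has_derivative (\<lambda>w. D (frechet_derivative (local_rep b c (\<lambda>q. q)) (at (snd b p)) w))) (at (snd b p))"
    by (rule local_rep_chart_change[OF b c F])
  from frechet_derivative_at[OF this, THEN fun_cong, of "v b"]
  have "differential A A F p v d = D (frechet_derivative (local_rep b c (\<lambda>q. q)) (at (snd b p)) (v b))"
    using d by (simp add: differential_def Let_def flip: b_def)
  also have "frechet_derivative (local_rep b c (\<lambda>q. q)) (at (snd b p)) (v b) = v c"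
    by (rule tangent_space_change[OF v b c])
  finally show ?thesis .
qed

lemma differential_in_tangent_space:
  assumes v: "v \<in> tangent_space A p" and p: "p \<in> topspace M" and F: "continuous_map M M F"
    and dF: "\<And>c d. c \<in> A \<Longrightarrow> p \<in> fst c \<Longrightarrow> d \<in> A \<Longrightarrow> F p \<in> fst d \<Longrightarrow> local_rep c d F differentiable (at (snd c p))"
  shows "differential A A F p v \<in> tangent_space A (F p)"
proof -
  obtain c where c: "c \<in> A" "p \<in> fst c" using ex_chart p by blast
  have change: "differential A A F p v e = frechet_derivative (local_rep d e (\<lambda>q. q)) (at (snd d (F p))) (differential A A F p v d)"
    if d: "d \<in> A" "F p \<in> fst d" and e: "e \<in> A" "F p \<in> fst e" for d e
  proof -
    have D: "(local_rep c d F has_derivative frechet_derivative (local_rep c d F) (at (snd c p))) (at (snd c p))"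
      using dF c d by (intro has_derivative_frechet)
    have "(local_rep c e F has_derivative (\<lambda>w. frechet_derivative (local_rep d e (\<lambda>q. q)) (at (snd d (F p)))
        (frechet_derivative (local_rep c d F) (at (snd c p)) w))) (at (snd c p))"
      by (rule local_rep_chain[where F = F, OF c d F D local_rep_id_has_derivative]) (use d e in auto)
    then show ?thesis
      using differential_chart[where F = F, OF v c e] differential_chart[where F = F, OF v c d D] by simp
  qed
  show ?thesis
  proof (rule tangent_spaceI)
    show "differential A A F p v c = 0" if "\<not> (c \<in> A \<and> F p \<in> fst c)" for c
      unfolding differential_def using that by (rule if_not_P)
  qed (rule change)
qed

lemma subspace_tangent_space: "subspace (tangent_space A p)"
proof -
  have lin: "linear (frechet_derivative (local_rep c d (\<lambda>q. q)) (at (snd c p)))"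
    if "c \<in> A" "d \<in> A" "p \<in> fst c" "p \<in> fst d" for c d
    using local_rep_id_has_derivative[OF that] has_derivative_linear by blast
  show ?thesis
  proof (rule subspaceI)
    show "0 \<in> tangent_space A p"
      using linear_0[OF lin] by (intro tangent_spaceI) auto
    show "v + w \<in> tangent_space A p" if v: "v \<in> tangent_space A p" and w: "w \<in> tangent_space A p" for v w
      using tangent_space_outside[OF v] tangent_space_outside[OF w]
      by (intro tangent_spaceI)
        (auto simp: linear_add[OF lin] tangent_space_change[OF v] tangent_space_change[OF w])
    show "r *\<^sub>R v \<in> tangent_space A p" if v: "v \<in> tangent_space A p" for r v
      using tangent_space_outside[OF v]
      by (intro tangent_spaceI) (auto simp: scaleR_fun_def linear_scale[OF lin] tangent_space_change[OF v])
  qed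
qed

end

section \<open>The adjoint representation\<close>

context lie_group
begin

lemma chart_carrier: "c \<in> A \<Longrightarrow> g \<in> fst c \<Longrightarrow> g \<in> carrier G"
  using chart_subset[of c] carrier_eq by blast

lemma continuous_mult: "continuous_map (prod_topology M M) M (\<lambda>(g, h). g \<otimes> h)"
  using smooth_mult unfolding smooth_map_def by (rule conjunct1)

lemma continuous_left_mult:
  assumes "g \<in> carrier G"
  shows "continuous_map M M (\<lambda>h. g \<otimes> h)"
proof -
  have "continuous_map M (prod_topology M M) (\<lambda>h. (g, h))"
    using assms by (simp add: continuous_map_paired carrier_eq)
  from continuous_map_compose[OF this continuous_mult] show ?thesis
    by (simp add: o_def)
qed

lemma continuous_right_mult:
  assumes "g \<in> carrier G"
  shows "continuous_map M M (\<lambda>h. h \<otimes> g)"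
proof -
  have "continuous_map M (prod_topology M M) (\<lambda>h. (h, g))"
    using assms by (simp add: continuous_map_paired carrier_eq)
  from continuous_map_compose[OF this continuous_mult] show ?thesis
    by (simp add: o_def)
qed

text \<open>Multiplication as one function of two coordinate vectors: derivatives of left and right
  translations become its partial derivatives, and can later be related by symmetry of its second
  derivative.\<close>

definition mult_rep :: "('g, 'e) chart \<Rightarrow> ('g, 'e) chart \<Rightarrow> ('g, 'e) chart \<Rightarrow> 'e \<times> 'e \<Rightarrow> 'e" where
  "mult_rep c d e = local_rep (fst c \<times> fst d, map_prod (snd c) (snd d)) e (\<lambda>(g, h). g \<otimes> h)"

definition mult_dom :: "('g, 'e) chart \<Rightarrow> ('g, 'e) chart \<Rightarrow> ('g, 'e) chart \<Rightarrow> ('e \<times> 'e) set" where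
  "mult_dom c d e = map_prod (snd c) (snd d) ` (fst c \<times> fst d \<inter> (\<lambda>(g, h). g \<otimes> h) -` fst e)"

lemma mult_rep_chart:
  assumes "c \<in> A" "d \<in> A" "g \<in> fst c" "h \<in> fst d"
  shows "mult_rep c d e (snd c g, snd d h) = snd e (g \<otimes> h)"
proof -
  have "inv_into (fst c \<times> fst d) (map_prod (snd c) (snd d)) (map_prod (snd c) (snd d) (g, h)) = (g, h)"
    using assms by (intro inv_into_f_f map_prod_inj_on inj_on_chart) auto
  then show ?thesis by (simp add: mult_rep_def local_rep_def)
qed

lemma mult_dom_mem:
  "g \<in> fst c \<Longrightarrow> h \<in> fst d \<Longrightarrow> g \<otimes> h \<in> fst e \<Longrightarrow> (snd c g, snd d h) \<in> mult_dom c d e"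
  unfolding mult_dom_def by (rule image_eqI[of _ _ "(g, h)"]) auto

lemma smooth_mult_rep:
  assumes "c \<in> A" "d \<in> A" "e \<in> A"
  shows "smooth_on (mult_dom c d e) (mult_rep c d e)"
proof -
  let ?p = "(fst c \<times> fst d, map_prod (snd c) (snd d))"
  have "?p \<in> prod_atlas A A"
    unfolding prod_atlas_def using assms by blast
  then have "smooth_on (snd ?p ` (fst ?p \<inter> (\<lambda>(g, h). g \<otimes> h) -` fst e)) (local_rep ?p e (\<lambda>(g, h). g \<otimes> h))"
    using smooth_mult assms(3) unfolding smooth_map_def by blast
  then show ?thesis by (simp add: mult_rep_def mult_dom_def)
qed

text \<open>\<open>smooth_on\<close> speaks of derivatives in the ambient space, so openness is
  needed to draw conclusions from it. It comes from continuity of the product, by way of a box of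
  chart neighbourhoods.\<close>

lemma open_mult_dom:
  assumes "c \<in> A" "d \<in> A" "e \<in> A"
  shows "open (mult_dom c d e)"
  unfolding open_prod_def
proof
  fix x assume "x \<in> mult_dom c d e"
  then obtain g h where gh: "g \<in> fst c" "h \<in> fst d" "g \<otimes> h \<in> fst e" "x = (snd c g, snd d h)"
    unfolding mult_dom_def by auto
  let ?W = "{z \<in> topspace (prod_topology M M). (case z of (g, h) \<Rightarrow> g \<otimes> h) \<in> fst e}"
  have W: "openin (prod_topology M M) ?W"
    by (rule openin_continuous_map_preimage[OF continuous_mult openin_chart[OF assms(3)]])
  have gh_W: "(g, h) \<in> ?W"
    using gh chart_subset[OF assms(1)] chart_subset[OF assms(2)] by auto
  obtain U V where UV: "openin M U" "openin M V" "g \<in> U" "h \<in> V" "U \<times> V \<subseteq> ?W"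
    using W[unfolded openin_prod_topology_alt, rule_format, OF gh_W] by (elim exE conjE)
  let ?U = "snd c ` (fst c \<inter> U)" and ?V = "snd d ` (fst d \<inter> V)"
  have "open ?U" "open ?V"
    using UV assms by (auto intro!: open_chart_image openin_Int openin_chart)
  moreover have "x \<in> ?U \<times> ?V" using gh UV by blast
  moreover have "?U \<times> ?V \<subseteq> mult_dom c d e"
  proof
    fix z assume "z \<in> ?U \<times> ?V"
    then obtain g' h' where "g' \<in> fst c" "g' \<in> U" "h' \<in> fst d" "h' \<in> V" "z = (snd c g', snd d h')"
      by blast
    then show "z \<in> mult_dom c d e" using UV(5) by (auto intro!: mult_dom_mem)
  qed
  ultimately show "\<exists>A B. open A \<and> open B \<and> x \<in> A \<times> B \<and> A \<times> B \<subseteq> mult_dom c d e"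
    by blast
qed

context
  fixes c d e g h
  assumes c: "c \<in> A" "g \<in> fst c" and d: "d \<in> A" "h \<in> fst d" and e: "e \<in> A" "g \<otimes> h \<in> fst e"
begin

lemma mult_rep_has_derivative:
  "(mult_rep c d e has_derivative frechet_derivative (mult_rep c d e) (at (snd c g, snd d h)))
    (at (snd c g, snd d h))"
proof -
  have "Ck_on 1 (mult_dom c d e) (mult_rep c d e)"
    using smooth_mult_rep c d e unfolding smooth_on_def by blast
  then show ?thesis
    using mult_dom_mem c d e by (intro has_derivative_frechet) auto
qed

text \<open>Left translation is \<open>mult_rep\<close> with its first slot frozen at the
  coordinates of \<open>g\<close>.\<close>

lemma left_mult_has_derivative:
  "(local_rep d e (\<lambda>h. g \<otimes> h) has_derivative
     (\<lambda>v. frechet_derivative (mult_rep c d e) (at (snd c g, snd d h)) (0, v))) (at (snd d h))"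
proof (rule has_derivative_transform_within_open)
  have "((\<lambda>y. (snd c g, y)) has_derivative (\<lambda>v. (0, v))) (at (snd d h))"
    by (auto intro!: derivative_eq_intros)
  from has_derivative_compose[OF this mult_rep_has_derivative]
  show "((\<lambda>y. mult_rep c d e (snd c g, y)) has_derivative
     (\<lambda>v. frechet_derivative (mult_rep c d e) (at (snd c g, snd d h)) (0, v))) (at (snd d h))" .
  show "open (snd d ` fst d)"
    by (rule open_chart_image[OF d(1) openin_chart[OF d(1)] order_refl])
  show "snd d h \<in> snd d ` fst d" using d(2) by (rule imageI)
  show "mult_rep c d e (snd c g, y) = local_rep d e (\<lambda>h. g \<otimes> h) y" if "y \<in> snd d ` fst d" for y
    using that c d by (auto simp: mult_rep_chart local_rep_chart)
qed

lemma right_mult_has_derivative: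
  "(local_rep c e (\<lambda>g. g \<otimes> h) has_derivative
     (\<lambda>v. frechet_derivative (mult_rep c d e) (at (snd c g, snd d h)) (v, 0))) (at (snd c g))"
proof (rule has_derivative_transform_within_open)
  have "((\<lambda>x. (x, snd d h)) has_derivative (\<lambda>v. (v, 0))) (at (snd c g))"
    by (auto intro!: derivative_eq_intros)
  from has_derivative_compose[OF this mult_rep_has_derivative]
  show "((\<lambda>x. mult_rep c d e (x, snd d h)) has_derivative
     (\<lambda>v. frechet_derivative (mult_rep c d e) (at (snd c g, snd d h)) (v, 0))) (at (snd c g))" .
  show "open (snd c ` fst c)"
    by (rule open_chart_image[OF c(1) openin_chart[OF c(1)] order_refl])
  show "snd c g \<in> snd c ` fst c" using c(2) by (rule imageI)
  show "mult_rep c d e (x, snd d h) = local_rep c e (\<lambda>g. g \<otimes> h) x" if "x \<in> snd c ` fst c" for x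
    using that c d by (auto simp: mult_rep_chart local_rep_chart)
qed

end

lemma continuous_conj:
  assumes "g \<in> carrier G"
  shows "continuous_map M M (\<lambda>h. g \<otimes> h \<otimes> inv g)"
  using continuous_map_compose[OF continuous_left_mult[OF assms] continuous_right_mult[OF inv_closed[OF assms]]]
  by (simp add: o_def)

text \<open>Conjugation is a left translation followed by a right translation; the intermediate
  chart lies around \<open>g\<close>, the image of \<open>\<one>\<close> under the first.\<close>

lemma conj_has_derivative:
  assumes g: "g \<in> carrier G" and c: "c \<in> A" "\<one> \<in> fst c" and d: "d \<in> A" "\<one> \<in> fst d"
  shows "(local_rep c d (\<lambda>h. g \<otimes> h \<otimes> inv g) has_derivative
    frechet_derivative (local_rep c d (\<lambda>h. g \<otimes> h \<otimes> inv g)) (at (snd c \<one>))) (at (snd c \<one>))"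
proof -
  obtain e where e: "e \<in> A" "g \<in> fst e" using ex_chart g carrier_eq by blast
  obtain i where i: "i \<in> A" "inv g \<in> fst i" using ex_chart g carrier_eq by blast
  have g1: "g \<otimes> \<one> = g" and gi: "g \<otimes> inv g = \<one>" using g by simp_all
  note L = left_mult_has_derivative[OF e c e(1), unfolded g1, OF e(2)]
  note R = right_mult_has_derivative[OF e i d(1), unfolded gi, OF d(2)]
  have "(local_rep c d (\<lambda>h. g \<otimes> h \<otimes> inv g) has_derivative
     (\<lambda>v. frechet_derivative (mult_rep e i d) (at (snd e g, snd i (inv g)))
            (frechet_derivative (mult_rep e c e) (at (snd e g, snd c \<one>)) (0, v), 0))) (at (snd c \<one>))"
    by (rule local_rep_chain[where F = "\<lambda>h. g \<otimes> h" and H = "\<lambda>k. k \<otimes> inv g" and d = e, OF c e(1) _ continuous_left_mult[OF g] L])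
      (simp_all add: g1 e(2) R)
  then show ?thesis
    by (intro has_derivative_frechet) (auto simp: differentiable_def)
qed

lemma conj_one: "g \<in> carrier G \<Longrightarrow> g \<otimes> \<one> \<otimes> inv g = \<one>"
  by simp

lemma Ad_chart:
  assumes g: "g \<in> carrier G" and v: "v \<in> lie_algebra G A"
    and c: "c \<in> A" "\<one> \<in> fst c" and d: "d \<in> A" "\<one> \<in> fst d"
  shows "Ad G A g v d = frechet_derivative (local_rep c d (\<lambda>h. g \<otimes> h \<otimes> inv g)) (at (snd c \<one>)) (v c)"
  unfolding Ad_def
proof (rule differential_chart[where F = "\<lambda>h. g \<otimes> h \<otimes> inv g"])
  show "v \<in> tangent_space A \<one>" using v unfolding lie_algebra_def .
  show "g \<otimes> \<one> \<otimes> inv g \<in> fst d" unfolding conj_one[OF g] by (rule d)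
qed (rule c d conj_has_derivative[OF g c d])+

lemma Ad_in_lie_algebra:
  assumes g: "g \<in> carrier G" and v: "v \<in> lie_algebra G A"
  shows "Ad G A g v \<in> lie_algebra G A"
proof -
  have "differential A A (\<lambda>h. g \<otimes> h \<otimes> inv g) \<one> v \<in> tangent_space A (g \<otimes> \<one> \<otimes> inv g)"
  proof (rule differential_in_tangent_space)
    show "v \<in> tangent_space A \<one>" using v by (simp add: lie_algebra_def)
    show "\<one> \<in> topspace M" using carrier_eq by blast
    show "local_rep c d (\<lambda>h. g \<otimes> h \<otimes> inv g) differentiable at (snd c \<one>)"
      if "c \<in> A" "\<one> \<in> fst c" "d \<in> A" "g \<otimes> \<one> \<otimes> inv g \<in> fst d" for c d
      using that conj_has_derivative[OF g, of c d] g unfolding differentiable_def by auto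
  qed (rule continuous_conj[OF g])
  then show ?thesis using g by (simp add: Ad_def lie_algebra_def)
qed

lemma one_topspace: "\<one> \<in> topspace M"
  using carrier_eq by blast

lemma lie_algebra_eqI:
  assumes "c \<in> A" "\<one> \<in> fst c" "v \<in> lie_algebra G A" "w \<in> lie_algebra G A" "v c = w c"
  shows "v = w"
  using assms unfolding lie_algebra_def by (rule tangent_space_eqI)

text \<open>Conjugations compose like group elements and fix \<open>\<one>\<close>, so the chain
  rule at \<open>\<one>\<close> gives the claim in one chart.\<close>

lemma Ad_mult:
  assumes g: "g \<in> carrier G" and h: "h \<in> carrier G" and v: "v \<in> lie_algebra G A"
  shows "Ad G A (g \<otimes> h) v = Ad G A g (Ad G A h v)"
proof -
  obtain c where c: "c \<in> A" "\<one> \<in> fst c" using ex_chart one_topspace by blast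
  have "(local_rep c c (\<lambda>k. (g \<otimes> h) \<otimes> k \<otimes> inv (g \<otimes> h)) has_derivative
     (\<lambda>v. frechet_derivative (local_rep c c (\<lambda>k. g \<otimes> k \<otimes> inv g)) (at (snd c \<one>))
        (frechet_derivative (local_rep c c (\<lambda>k. h \<otimes> k \<otimes> inv h)) (at (snd c \<one>)) v))) (at (snd c \<one>))"
  proof (rule local_rep_chain[where F = "\<lambda>k. h \<otimes> k \<otimes> inv h" and H = "\<lambda>k. g \<otimes> k \<otimes> inv g" and d = c
        and D' = "frechet_derivative (local_rep c c (\<lambda>k. g \<otimes> k \<otimes> inv g)) (at (snd c \<one>))"])
    show "(g \<otimes> h) \<otimes> q \<otimes> inv (g \<otimes> h) = g \<otimes> (h \<otimes> q \<otimes> inv h) \<otimes> inv g" if "q \<in> topspace M" for q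
      using that g h by (simp add: inv_mult_group m_assoc flip: carrier_eq)
    show "(local_rep c c (\<lambda>k. g \<otimes> k \<otimes> inv g) has_derivative
       frechet_derivative (local_rep c c (\<lambda>k. g \<otimes> k \<otimes> inv g)) (at (snd c \<one>))) (at (snd c (h \<otimes> \<one> \<otimes> inv h)))"
      unfolding conj_one[OF h] by (rule conj_has_derivative[OF g c c])
    show "h \<otimes> \<one> \<otimes> inv h \<in> fst c" unfolding conj_one[OF h] by (rule c)
  qed (rule c continuous_conj[OF h] conj_has_derivative[OF h c c])+
  from frechet_derivative_at[OF this, THEN fun_cong, of "v c"]
  have "Ad G A (g \<otimes> h) v c = Ad G A g (Ad G A h v) c"
    using Ad_chart[OF _ v c c] Ad_chart[OF g Ad_in_lie_algebra[OF h v] c c] g h by simp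
  then show ?thesis
    using Ad_in_lie_algebra g h v by (intro lie_algebra_eqI[OF c]) auto
qed

lemma Ad_one:
  assumes v: "v \<in> lie_algebra G A"
  shows "Ad G A \<one> v = v"
proof -
  obtain c where c: "c \<in> A" "\<one> \<in> fst c" using ex_chart one_topspace by blast
  have "(local_rep c c (\<lambda>h. \<one> \<otimes> h \<otimes> inv \<one>) has_derivative (\<lambda>v. v)) (at (snd c \<one>))"
  proof (rule has_derivative_transform_within_open[OF local_rep_id_same[OF c]])
    show "open (snd c ` fst c)"
      by (rule open_chart_image[OF c(1) openin_chart[OF c(1)] order_refl])
    show "snd c \<one> \<in> snd c ` fst c" using c(2) by (rule imageI)
    show "local_rep c c (\<lambda>p. p) x = local_rep c c (\<lambda>h. \<one> \<otimes> h \<otimes> inv \<one>) x" if "x \<in> snd c ` fst c" for x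
      using that c chart_carrier[OF c(1)] by (auto simp: local_rep_chart)
  qed
  from frechet_derivative_at[OF this, THEN fun_cong, of "v c"]
  have "Ad G A \<one> v c = v c"
    using Ad_chart[OF one_closed v c c] by simp
  then show ?thesis
    using Ad_in_lie_algebra[OF one_closed v] v by (intro lie_algebra_eqI[OF c])
qed

text \<open>Makes the field an explicit partial derivative of \<open>mult_rep\<close>, so that the
  bracket becomes an expression in second derivatives.\<close>

lemma left_invariant_field_chart:
  assumes v: "v \<in> lie_algebra G A" and c: "c \<in> A" "\<one> \<in> fst c" "g \<in> fst c"
  shows "left_invariant_field G A v g c =
    frechet_derivative (mult_rep c c c) (at (snd c g, snd c \<one>)) (0, v c)"
proof -
  have g1: "g \<otimes> \<one> = g" using chart_carrier c by simp
  show ?thesis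
    unfolding left_invariant_field_def
  proof (rule differential_chart[where F = "\<lambda>h. g \<otimes> h"])
    show "v \<in> tangent_space A \<one>" using v unfolding lie_algebra_def .
    show "(local_rep c c (\<lambda>h. g \<otimes> h) has_derivative
      (\<lambda>w. frechet_derivative (mult_rep c c c) (at (snd c g, snd c \<one>)) (0, w))) (at (snd c \<one>))"
      by (rule left_mult_has_derivative) (use c g1 in simp_all)
  qed (use c g1 in simp_all)
qed

text \<open>
  In a chart at \<open>\<one>\<close> with \<open>x0\<close> the image of \<open>\<one>\<close> and \<open>\<mu>\<close> the product, put \<open>L x = D\<^sub>2 \<mu>(x, x0)\<close> and
  \<open>R x = D\<^sub>1 \<mu>(x0, x)\<close>. Differentiating \<open>g h = (g h g\<inverse>) g\<close> in \<open>h\<close> gives \<open>R x (Ad x v) = L x v\<close>, so \<open>Ad\<close>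
  can be differentiated in \<open>x\<close> without touching the derivative of inversion. The bracket is
  \<open>L' \<eta> v - L' v \<eta>\<close>, and \<open>R'\<close> is turned into \<open>L'\<close> by the symmetry of second derivatives.
\<close>

lemma Ad_has_derivative:
  assumes v: "v \<in> lie_algebra G A" and c: "c \<in> A" "\<one> \<in> fst c"
  shows "((\<lambda>x. Ad G A (chart_inv c x) v c) has_derivative
    (\<lambda>\<eta>. lie_bracket G A (tangent_lift \<one> c \<eta>) v c)) (at (snd c \<one>))"
proof -
  let ?x = "snd c \<one>" and ?S = "snd c ` fst c" and ?\<Omega> = "mult_dom c c c"
  let ?D = "\<lambda>p. frechet_derivative (mult_rep c c c) (at p)"
  \<comment> \<open>\<open>?D2 w u\<close> differentiates first in direction \<open>w\<close>, then
    in direction \<open>u\<close>. A pair with zero second or first entry selects the left or the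
    right factor of the product.\<close>
  let ?D2 = "\<lambda>w. frechet_derivative (\<lambda>p. ?D p w) (at (?x, ?x))"
  have S: "open ?S" by (rule open_chart_image[OF c(1) openin_chart[OF c(1)] order_refl])
  have x: "?x \<in> ?S" using c(2) by (rule imageI)
  have \<Omega>: "open ?\<Omega>" "(?x, ?x) \<in> ?\<Omega>"
    using open_mult_dom c by (auto intro!: mult_dom_mem)
  have C2: "Ck_on 2 ?\<Omega> (mult_rep c c c)"
    using smooth_mult_rep[OF c(1) c(1) c(1)] unfolding smooth_on_def by blast
  have D2: "((\<lambda>p. ?D p w) has_derivative ?D2 w) (at (?x, ?x))" for w
  proof (rule has_derivative_frechet)
    show "(\<lambda>p. ?D p w) differentiable (at (?x, ?x))"
      using C2 \<Omega>(2) unfolding numeral_2_eq_2 Ck_on.simps by blast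
  qed
  have D2_sym: "?D2 w u = ?D2 u w" for u w
    by (rule mixed_partials[OF C2 \<Omega>])
  have lin: "linear (?D2 w)" for w
    using D2 has_derivative_linear by blast
  have L': "((\<lambda>x. ?D (x, ?x) (0, w)) has_derivative (\<lambda>\<eta>. ?D2 (0, w) (\<eta>, 0))) (at ?x)" for w
  proof -
    have "((\<lambda>x. (x, ?x)) has_derivative (\<lambda>\<eta>. (\<eta>, 0))) (at ?x)"
      by (auto intro!: derivative_eq_intros)
    from has_derivative_compose[OF this D2] show ?thesis .
  qed
  have R': "((\<lambda>x. ?D (?x, x) (w, 0)) has_derivative (\<lambda>\<eta>. ?D2 (w, 0) (0, \<eta>))) (at ?x)" for w
  proof -
    have "((\<lambda>x. (?x, x)) has_derivative (\<lambda>\<eta>. (0, \<eta>))) (at ?x)"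
      by (auto intro!: derivative_eq_intros)
    from has_derivative_compose[OF this D2] show ?thesis .
  qed
  have L: "(local_rep c c (\<lambda>h. g \<otimes> h) has_derivative (\<lambda>w. ?D (snd c g, ?x) (0, w))) (at ?x)"
    if "g \<in> fst c" for g
    by (rule left_mult_has_derivative) (use c that chart_carrier in simp_all)
  have R: "(local_rep c c (\<lambda>h. h \<otimes> g) has_derivative (\<lambda>w. ?D (?x, snd c g) (w, 0))) (at ?x)"
    if "g \<in> fst c" for g
    by (rule right_mult_has_derivative) (use c that chart_carrier in simp_all)
  have id: "(local_rep c c F has_derivative (\<lambda>v. v)) (at ?x)" if "\<And>h. h \<in> fst c \<Longrightarrow> F h = h" for F
    by (rule has_derivative_transform_within_open[OF local_rep_id_same[OF c] S x])
      (use that c in \<open>auto simp: local_rep_chart\<close>)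
  \<comment> \<open>Translation by \<open>\<one>\<close> is the identity on the chart
    domain.\<close>
  have L0: "?D (?x, ?x) (0, w) = w" for w
    using has_derivative_unique[OF L[OF c(2)] id, THEN fun_cong, of w] chart_carrier[OF c(1)] by simp
  have R0: "?D (?x, ?x) (w, 0) = w" for w
    using has_derivative_unique[OF R[OF c(2)] id, THEN fun_cong, of w] chart_carrier[OF c(1)] by simp
  have key: "?D (?x, x) (Ad G A (chart_inv c x) v c, 0) = ?D (x, ?x) (0, v c)" if xS: "x \<in> ?S" for x
  proof -
    obtain g where g: "g \<in> fst c" "x = snd c g" using xS by blast
    then have gG: "g \<in> carrier G" using chart_carrier c by blast
    have "(local_rep c c (\<lambda>h. g \<otimes> h) has_derivative (\<lambda>w. ?D (?x, snd c g)
      (frechet_derivative (local_rep c c (\<lambda>h. g \<otimes> h \<otimes> inv g)) (at ?x) w, 0))) (at ?x)"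
    proof (rule local_rep_chain[where F = "\<lambda>h. g \<otimes> h \<otimes> inv g" and H = "\<lambda>h. h \<otimes> g" and d = c
          and D' = "\<lambda>w. ?D (?x, snd c g) (w, 0)"])
      show "(local_rep c c (\<lambda>h. h \<otimes> g) has_derivative (\<lambda>w. ?D (?x, snd c g) (w, 0)))
          (at (snd c (g \<otimes> \<one> \<otimes> inv g)))"
        unfolding conj_one[OF gG] by (rule R[OF g(1)])
      show "g \<otimes> \<one> \<otimes> inv g \<in> fst c" unfolding conj_one[OF gG] by (rule c)
      show "g \<otimes> q = g \<otimes> q \<otimes> inv g \<otimes> g" if "q \<in> topspace M" for q
        using that gG by (simp add: m_assoc flip: carrier_eq)
    qed (rule c continuous_conj[OF gG] conj_has_derivative[OF gG c c])+
    from has_derivative_unique[OF this L[OF g(1)], THEN fun_cong, of "v c"]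
    show ?thesis
      using Ad_chart[OF gG v c c] by (simp add: g chart_inv_chart[OF c(1)])
  qed
  have linR: "linear (\<lambda>w. ?D (?x, x) (w, 0))" if "x \<in> ?S" for x
    using that R has_derivative_linear by blast
  have Ad1: "Ad G A (chart_inv c ?x) v c = v c"
    using Ad_one[OF v] by (simp add: chart_inv_chart[OF c])
  have "((\<lambda>x. Ad G A (chart_inv c x) v c) has_derivative
    (\<lambda>\<eta>. ?D2 (0, v c) (\<eta>, 0) - ?D2 (Ad G A (chart_inv c ?x) v c, 0) (0, \<eta>))) (at ?x)"
    by (rule has_derivative_linear_solution[OF S x linR key R0 L' R'])
  \<comment> \<open>After the swap the second term is the derivative along \<open>v c\<close> of the
    left-invariant field of \<open>\<eta>\<close>, which is the other half of the bracket.\<close>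
  then have "((\<lambda>x. Ad G A (chart_inv c x) v c) has_derivative
    (\<lambda>\<eta>. ?D2 (0, v c) (\<eta>, 0) - ?D2 (0, \<eta>) (v c, 0))) (at ?x)"
    unfolding Ad1 D2_sym[of "(v c, 0)"] .
  also have "(\<lambda>\<eta>. ?D2 (0, v c) (\<eta>, 0) - ?D2 (0, \<eta>) (v c, 0)) =
    (\<lambda>\<eta>. lie_bracket G A (tangent_lift \<one> c \<eta>) v c)"
  proof
    fix \<eta>
    let ?u = "tangent_lift \<one> c \<eta>"
    have u: "?u \<in> lie_algebra G A" "?u c = \<eta>"
      using tangent_lift_in_tangent_space[OF c] tangent_lift_chart[OF c] by (simp_all add: lie_algebra_def)
    have field: "frechet_derivative (\<lambda>x. left_invariant_field G A w (chart_inv c x) c) (at ?x) =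
        (\<lambda>\<eta>. ?D2 (0, w c) (\<eta>, 0))" if "w \<in> lie_algebra G A" for w
    proof (rule sym[OF frechet_derivative_at])
      show "((\<lambda>x. left_invariant_field G A w (chart_inv c x) c) has_derivative
        (\<lambda>\<eta>. ?D2 (0, w c) (\<eta>, 0))) (at ?x)"
        by (rule has_derivative_transform_within_open[OF L' S x])
          (use left_invariant_field_chart[OF that c] chart_inv_chart[OF c(1)] in auto)
    qed
    have at_one: "left_invariant_field G A w \<one> c = w c" if "w \<in> lie_algebra G A" for w
      using left_invariant_field_chart[OF that c c(2)] L0 by simp
    show "?D2 (0, v c) (\<eta>, 0) - ?D2 (0, \<eta>) (v c, 0) = lie_bracket G A ?u v c"
      using c by (simp add: lie_bracket_def field_bracket_def field[OF u(1)] field[OF v] at_one[OF u(1)] at_one[OF v] u(2))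
  qed
  finally show ?thesis .
qed

lemma tangent_lift_self:
  assumes "v \<in> lie_algebra G A" "c \<in> A" "\<one> \<in> fst c"
  shows "tangent_lift \<one> c (v c) = v"
  using assms tangent_lift_eval unfolding lie_algebra_def by blast

text \<open>The bracket is defined chart by chart. Its compatibility follows by differentiating that
  of \<open>Ad\<close>: the vectors \<open>Ad g v\<close> all sit at \<open>\<one>\<close>, so the
  transition derivative \<open>?T\<close> is a constant linear map and no second derivatives of
  transition maps arise.\<close>

lemma lie_bracket_in_lie_algebra:
  assumes u: "u \<in> lie_algebra G A" and v: "v \<in> lie_algebra G A"
  shows "lie_bracket G A u v \<in> lie_algebra G A"
  unfolding lie_algebra_def
proof (rule tangent_spaceI)
  show "lie_bracket G A u v c = 0" if "\<not> (c \<in> A \<and> \<one> \<in> fst c)" for c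
    unfolding lie_bracket_def field_bracket_def using that by (rule if_not_P)
next
  fix c d assume c: "c \<in> A" "\<one> \<in> fst c" and d: "d \<in> A" "\<one> \<in> fst d"
  let ?T = "frechet_derivative (local_rep c d (\<lambda>q. q)) (at (snd c \<one>))"
  have T: "(local_rep c d (\<lambda>q. q) has_derivative ?T) (at (snd c \<one>))"
    by (rule local_rep_id_has_derivative[OF c(1) d(1) c(2) d(2)])
  have Tu: "?T (u c) = u d"
    using tangent_space_change[OF _ c d] u unfolding lie_algebra_def by blast
  have "((\<lambda>x. ?T (Ad G A (chart_inv c x) v c)) has_derivative
      (\<lambda>\<eta>. ?T (lie_bracket G A (tangent_lift \<one> c \<eta>) v c))) (at (snd c \<one>))"
    using linear_imp_has_derivative[OF has_derivative_linear[OF T]] 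
    by (rule has_derivative_compose[OF Ad_has_derivative[OF v c]])
  moreover have "((\<lambda>x. ?T (Ad G A (chart_inv c x) v c)) has_derivative
      (\<lambda>\<eta>. lie_bracket G A (tangent_lift \<one> d (?T \<eta>)) v d)) (at (snd c \<one>))"
  proof (rule has_derivative_transform_within_open)
    show "((\<lambda>x. Ad G A (chart_inv d (local_rep c d (\<lambda>q. q) x)) v d) has_derivative
      (\<lambda>\<eta>. lie_bracket G A (tangent_lift \<one> d (?T \<eta>)) v d)) (at (snd c \<one>))"
      by (rule has_derivative_compose[OF T]) (simp add: local_rep_chart[OF c] Ad_has_derivative[OF v d])
    show "open (snd c ` (fst c \<inter> fst d))"
      by (intro open_chart_image openin_Int openin_chart c d) blast
    show "snd c \<one> \<in> snd c ` (fst c \<inter> fst d)" using c d by blast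
    show "Ad G A (chart_inv d (local_rep c d (\<lambda>q. q) x)) v d = ?T (Ad G A (chart_inv c x) v c)"
      if x: "x \<in> snd c ` (fst c \<inter> fst d)" for x
    proof -
      obtain g where g: "g \<in> fst c" "g \<in> fst d" "x = snd c g" using x by blast
      then have "Ad G A g v \<in> tangent_space A \<one>"
        using Ad_in_lie_algebra[OF chart_carrier[OF c(1)] v] unfolding lie_algebra_def by blast
      from tangent_space_change[OF this c d] show ?thesis
        by (simp add: g(3) local_rep_chart[OF c(1) g(1)] chart_inv_chart[OF c(1) g(1)] chart_inv_chart[OF d(1) g(2)])
    qed
  qed
  ultimately have "(\<lambda>\<eta>. lie_bracket G A (tangent_lift \<one> d (?T \<eta>)) v d) =
      (\<lambda>\<eta>. ?T (lie_bracket G A (tangent_lift \<one> c \<eta>) v c))"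
    using has_derivative_unique by blast
  from fun_cong[OF this, of "u c"] show "lie_bracket G A u v d = ?T (lie_bracket G A u v c)"
    unfolding Tu tangent_lift_self[OF u c] tangent_lift_self[OF u d] .
qed

text \<open>Continuity at \<open>\<one>\<close> comes from differentiability there; it is carried to
  \<open>g\<close> by writing \<open>Ad (g \<otimes> h)\<close> as the fixed linear map
  \<open>Ad g\<close> after \<open>Ad h\<close>.\<close>

lemma continuous_Ad:
  assumes v: "v \<in> lie_algebra G A" and c: "c \<in> A" "\<one> \<in> fst c"
  shows "continuous_map M euclidean (\<lambda>g. Ad G A g v c)"
  unfolding continuous_map_eq_topcontinuous_at topcontinuous_at_def
proof (intro ballI conjI allI impI)
  fix g assume g: "g \<in> topspace M"
  then have gG: "g \<in> carrier G" using carrier_eq by simp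
  show "g \<in> topspace M" by (rule g)
  show "(\<lambda>g. Ad G A g v c) \<in> topspace M \<rightarrow> topspace euclidean" by simp
  fix V :: "'e set" assume V: "openin euclidean V \<and> Ad G A g v c \<in> V"
  let ?T = "frechet_derivative (local_rep c c (\<lambda>h. g \<otimes> h \<otimes> inv g)) (at (snd c \<one>))"
  have T: "isCont ?T w" for w
    using has_derivative_continuous[OF linear_imp_has_derivative[OF has_derivative_linear[OF conj_has_derivative[OF gG c c]]]] .
  have near_one: "Ad G A (g \<otimes> h) v c = ?T (Ad G A h v c)" if "h \<in> carrier G" for h
    using Ad_mult[OF gG that v] Ad_chart[OF gG Ad_in_lie_algebra[OF that v] c c] by simp
  have "isCont (\<lambda>x. ?T (Ad G A (chart_inv c x) v c)) (snd c \<one>)"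
    using isCont_o2[OF has_derivative_continuous[OF Ad_has_derivative[OF v c]] T] .
  moreover have "?T (Ad G A (chart_inv c (snd c \<one>)) v c) \<in> V"
    using V near_one[OF one_closed] gG by (simp add: chart_inv_chart[OF c])
  ultimately obtain B where B: "open B" "snd c \<one> \<in> B" "\<And>x. x \<in> B \<Longrightarrow> ?T (Ad G A (chart_inv c x) v c) \<in> V"
    using V unfolding continuous_at_open by (metis open_openin)
  let ?N = "{h \<in> fst c. snd c h \<in> B}"
  \<comment> \<open>The left translate by \<open>g\<close> of a chart neighbourhood of
    \<open>\<one>\<close>, written as a preimage to make it open.\<close>
  let ?U = "{k \<in> topspace M. inv g \<otimes> k \<in> ?N}"
  have "openin M ?U"
    by (rule openin_continuous_map_preimage[OF continuous_left_mult[OF inv_closed[OF gG]] openin_chart_preimage[OF c(1) B(1)]])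
  moreover have "g \<in> ?U" using g gG c B(2) by simp
  moreover have "Ad G A k v c \<in> V" if k: "k \<in> ?U" for k
  proof -
    let ?h = "inv g \<otimes> k"
    have kG: "k \<in> carrier G" using k carrier_eq by simp
    then have "g \<otimes> ?h = k" using gG by (simp flip: m_assoc)
    then have "Ad G A k v c = ?T (Ad G A ?h v c)"
      using near_one[of ?h] gG kG by simp
    also have "?h = chart_inv c (snd c ?h)" using k chart_inv_chart[OF c(1), of ?h] by simp
    finally show ?thesis using B(3)[of "snd c ?h"] k by simp
  qed
  ultimately show "\<exists>U. openin M U \<and> g \<in> U \<and> (\<forall>y\<in>U. Ad G A y v c \<in> V)" by blast
qed

end

section \<open>Passage to coordinates in one chart\<close>

lemma sum_fun_apply: "(\<Sum>i\<in>I. f i) x = (\<Sum>i\<in>I. f i x)"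
  by (induction I rule: infinite_finite_induct) auto

context lie_group
begin

text \<open>The curve is a straight line in the chart. Its velocity at 0 determines the derivative
  of \<open>Ad\<close> there, so it need not be a homomorphism.\<close>

lemma ex_curve_tangent:
  assumes c: "c \<in> A" "\<one> \<in> fst c"
  shows "\<exists>\<gamma> \<epsilon>. 0 < \<epsilon> \<and> \<gamma> 0 = \<one> \<and> (\<forall>t. \<bar>t\<bar> < \<epsilon> \<longrightarrow> \<gamma> t \<in> carrier G) \<and>
    (\<forall>v\<in>lie_algebra G A. continuous_on {-\<epsilon><..<\<epsilon>} (\<lambda>t. Ad G A (\<gamma> t) v c) \<and>
      ((\<lambda>t. Ad G A (\<gamma> t) v c) has_vector_derivative lie_bracket G A (tangent_lift \<one> c u) v c) (at 0))"
proof -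
  let ?S = "snd c ` fst c" and ?x = "snd c \<one>"
  have "open ?S" by (rule open_chart_image[OF c(1) openin_chart[OF c(1)] order_refl])
  moreover have "?x \<in> ?S" using c(2) by (rule imageI)
  ultimately obtain r where r: "0 < r" "ball ?x r \<subseteq> ?S"
    using openE by blast
  \<comment> \<open>The summand 1 covers \<open>u = 0\<close>; the line stays in the ball of radius
    \<open>r\<close> as long as \<open>\<bar>t\<bar> < \<epsilon>\<close>.\<close>
  define \<epsilon> where "\<epsilon> = r / (1 + norm u)"
  have \<epsilon>: "0 < \<epsilon>" using r(1) by (simp add: \<epsilon>_def add_pos_nonneg)
  have line: "?x + t *\<^sub>R u \<in> ?S" if t: "\<bar>t\<bar> < \<epsilon>" for t
  proof -
    have "\<bar>t\<bar> * norm u \<le> \<bar>t\<bar> * (1 + norm u)" by (intro mult_left_mono) auto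
    also have "\<dots> < r" using t by (simp add: \<epsilon>_def pos_less_divide_eq add_pos_nonneg)
    finally have "?x + t *\<^sub>R u \<in> ball ?x r" by (simp add: dist_norm)
    then show ?thesis using r(2) by blast
  qed
  define \<gamma> where "\<gamma> t = chart_inv c (?x + t *\<^sub>R u)" for t
  have \<gamma>_in: "\<gamma> t \<in> fst c" if "\<bar>t\<bar> < \<epsilon>" for t
    unfolding \<gamma>_def by (rule inv_into_into[OF line[OF that]])
  have cont: "continuous_on {-\<epsilon><..<\<epsilon>} (\<lambda>t. Ad G A (\<gamma> t) v c)" if v: "v \<in> lie_algebra G A" for v
  proof -
    have "continuous_on {-\<epsilon><..<\<epsilon>} (\<lambda>t. ?x + t *\<^sub>R u)" by (intro continuous_intros)
    then have "continuous_map (top_of_set {-\<epsilon><..<\<epsilon>}) (top_of_set ?S) (\<lambda>t. ?x + t *\<^sub>R u)"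
      using line by (simp add: continuous_map_in_subtopology image_subset_iff abs_less_iff minus_less_iff)
    from continuous_map_compose[OF continuous_map_compose[OF this continuous_map_chart_inv[OF c(1)]] continuous_Ad[OF v c]]
    show ?thesis by (simp add: o_def \<gamma>_def)
  qed
  have der: "((\<lambda>t. Ad G A (\<gamma> t) v c) has_vector_derivative lie_bracket G A (tangent_lift \<one> c u) v c) (at 0)"
    if v: "v \<in> lie_algebra G A" for v
  proof -
    have D: "((\<lambda>x. Ad G A (chart_inv c x) v c) has_derivative
        (\<lambda>\<eta>. lie_bracket G A (tangent_lift \<one> c \<eta>) v c)) (at (?x + 0 *\<^sub>R u))"
      using Ad_has_derivative[OF v c] by simp
    have "((\<lambda>t. ?x + t *\<^sub>R u) has_derivative (\<lambda>t. t *\<^sub>R u)) (at 0)"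
      by (auto intro!: derivative_eq_intros)
    from has_derivative_compose[OF this D]
    show ?thesis
      unfolding has_vector_derivative_def \<gamma>_def
      using linear_scale[OF has_derivative_linear[OF D]] by simp
  qed
  show ?thesis
  proof (intro exI[of _ \<gamma>] exI[of _ \<epsilon>] conjI allI impI ballI)
    show "\<gamma> 0 = \<one>" unfolding \<gamma>_def using chart_inv_chart[OF c] by simp
    show "\<gamma> t \<in> carrier G" if "\<bar>t\<bar> < \<epsilon>" for t
      using \<gamma>_in[OF that] by (rule chart_carrier[OF c(1)])
  qed (rule \<epsilon> cont der; assumption)+
qed

text \<open>Evaluation at \<open>c\<close> and \<open>tangent_lift\<close> are mutually inverse
  between the Lie algebra and the model space, so \<open>Ad\<close>, the bracket and simplicity all
  transfer.\<close>

lemma compact_adjoint_rep_Ad: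
  assumes simple: "simple_lie_algebra (lie_algebra G A) (lie_bracket G A)"
    and compact: "compact_space M" and c: "c \<in> A" "\<one> \<in> fst c"
  shows "compact_adjoint_rep G M (\<lambda>g w. Ad G A g (tangent_lift \<one> c w) c)
    (\<lambda>u w. lie_bracket G A (tangent_lift \<one> c u) (tangent_lift \<one> c w) c)"
proof (intro compact_adjoint_rep.intro[OF group_axioms] compact_adjoint_rep_axioms.intro)
  let ?L = "lie_algebra G A" and ?E = "tangent_lift \<one> c"
  have E: "?E w \<in> ?L" "?E w c = w" for w
    using tangent_lift_in_tangent_space[OF c] tangent_lift_chart[OF c] by (simp_all add: lie_algebra_def)
  have E_eval: "?E (v c) = v" if "v \<in> ?L" for v
    by (rule tangent_lift_self[OF that c])
  have subL: "subspace ?L" unfolding lie_algebra_def by (rule subspace_tangent_space)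
  show "carrier G = topspace M" by (rule carrier_eq)
  show "compact_space M" by (rule compact)
  show "linear (\<lambda>w. Ad G A g (?E w) c)" if "g \<in> carrier G" for g
    unfolding Ad_chart[OF that E(1) c c] E(2)
    using has_derivative_linear[OF conj_has_derivative[OF that c c]] .
  show "Ad G A (g \<otimes> h) (?E v) c = Ad G A g (?E (Ad G A h (?E v) c)) c"
    if "g \<in> carrier G" "h \<in> carrier G" for g h v
    unfolding E_eval[OF Ad_in_lie_algebra[OF that(2) E(1)]] Ad_mult[OF that E(1)] ..
  show "Ad G A \<one> (?E v) c = v" for v
    unfolding Ad_one[OF E(1)] by (rule E(2))
  show "continuous_map M euclidean (\<lambda>g. Ad G A g (?E v) c)" for v
    by (rule continuous_Ad[OF E(1) c])
  show "\<exists>\<gamma> \<epsilon>. 0 < \<epsilon> \<and> \<gamma> 0 = \<one> \<and> (\<forall>t. \<bar>t\<bar> < \<epsilon> \<longrightarrow> \<gamma> t \<in> carrier G) \<and>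
      (\<forall>v. continuous_on {-\<epsilon><..<\<epsilon>} (\<lambda>t. Ad G A (\<gamma> t) (?E v) c) \<and>
        ((\<lambda>t. Ad G A (\<gamma> t) (?E v) c) has_vector_derivative lie_bracket G A (?E u) (?E v) c) (at 0))" for u
    using ex_curve_tangent[OF c, of u] E(1) by blast
  obtain x y where xy: "x \<in> ?L" "y \<in> ?L" "lie_bracket G A x y \<noteq> 0"
    using simple unfolding simple_lie_algebra_def by blast
  have "lie_bracket G A (?E (x c)) (?E (y c)) c \<noteq> 0"
  proof
    assume "lie_bracket G A (?E (x c)) (?E (y c)) c = 0"
    then have "lie_bracket G A x y c = (0 :: ('g, 'e) chart \<Rightarrow> 'e) c"
      using E_eval xy by simp
    then have "lie_bracket G A x y = 0"
      by (rule lie_algebra_eqI[OF c lie_bracket_in_lie_algebra[OF xy(1,2)] subspace_0[OF subL]])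
    with xy(3) show False by blast
  qed
  then show "\<exists>u v. lie_bracket G A (?E u) (?E v) c \<noteq> 0" by blast
  fix I :: "'e set"
  assume I: "subspace I" and ideal: "\<And>u v. v \<in> I \<Longrightarrow> lie_bracket G A (?E u) (?E v) c \<in> I"
  \<comment> \<open>Simplicity is stated for ideals of tangent vectors, hence \<open>I\<close> is
    pulled back along evaluation at \<open>c\<close>.\<close>
  let ?J = "{v \<in> ?L. v c \<in> I}"
  have "subspace ?J"
    using subL I unfolding subspace_def by (auto simp: scaleR_fun_def)
  moreover have "lie_bracket G A x y \<in> ?J" if "x \<in> ?L" "y \<in> ?J" for x y
    using that ideal[of "y c" "x c"] lie_bracket_in_lie_algebra[of x y] E_eval[of x] E_eval[of y] by simp
  ultimately have "lie_ideal ?L (lie_bracket G A) ?J"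
    unfolding lie_ideal_def by blast
  then have "?J = {0} \<or> ?J = ?L"
    using simple unfolding simple_lie_algebra_def by blast
  then show "I = {0} \<or> I = UNIV"
  proof
    assume J: "?J = {0}"
    have "w = 0" if "w \<in> I" for w
    proof -
      have "?E w \<in> ?J" using E that by simp
      then have "?E w = 0" unfolding J by blast
      then show "w = 0" using E(2)[of w] by simp
    qed
    then show ?thesis using subspace_0[OF I] by blast
  next
    assume J: "?J = ?L"
    have "w \<in> I" for w
    proof -
      have "?E w \<in> ?J" unfolding J by (rule E(1))
      then show ?thesis using E(2) by simp
    qed
    then show ?thesis by blast
  qed
qed

end

theorem theorem3:
  fixes G :: "('g, 'm) monoid_scheme"
    and M :: "'g topology"
    and A :: "('g, 'e::euclidean_space) chart set"
    and \<xi> :: "('g, 'e) chart \<Rightarrow> 'e"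
  assumes "simple_lie_group G M A"
    and "compact_space M"
    and "\<xi> \<in> lie_algebra G A"
    and "\<xi> \<noteq> 0"
  shows "\<exists>m\<ge>1. \<exists>U. openin (top_of_set (lie_algebra G A)) U \<and> 0 \<in> U \<and> U \<subseteq> orbit_sum G A \<xi> m"
proof -
  interpret lie_group G M A
    using assms(1) unfolding simple_lie_group_def by blast
  let ?L = "lie_algebra G A"
  obtain c where c: "c \<in> A" "\<one>\<^bsub>G\<^esub> \<in> fst c"
    using ex_chart[OF one_topspace] by blast
  interpret rep: compact_adjoint_rep G M "\<lambda>g w. Ad G A g (tangent_lift \<one>\<^bsub>G\<^esub> c w) c"
    "\<lambda>u w. lie_bracket G A (tangent_lift \<one>\<^bsub>G\<^esub> c u) (tangent_lift \<one>\<^bsub>G\<^esub> c w) c"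
    using assms(1,2) by (intro compact_adjoint_rep_Ad c) (simp_all add: simple_lie_group_def)
  have subL: "subspace ?L" unfolding lie_algebra_def by (rule subspace_tangent_space)
  have "\<xi> c \<noteq> 0"
  proof
    assume "\<xi> c = 0"
    then have "\<xi> c = (0 :: ('g, 'e) chart \<Rightarrow> 'e) c" by simp
    then have "\<xi> = 0" by (rule lie_algebra_eqI[OF c assms(3) subspace_0[OF subL]])
    with assms(4) show False by blast
  qed
  then obtain m r where m: "1 \<le> m" and r: "0 < r" "ball 0 r \<subseteq> sumset (rep.orbit (\<xi> c)) m"
    using rep.sumset_orbit_nhd_zero by blast
  \<comment> \<open>Evaluation at \<open>c\<close> is continuous in the product topology, so a
    condition on this one coordinate cuts out an open subset of the Lie algebra.\<close>
  let ?U = "{v \<in> ?L. v c \<in> ball 0 r}"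
  have "openin (top_of_set ?L) ?U"
  proof -
    have "open ((\<lambda>v :: ('g, 'e) chart \<Rightarrow> 'e. v c) -` ball 0 r)"
      by (rule open_vimage[OF open_ball continuous_on_product_coordinates])
    moreover have "?U = ?L \<inter> (\<lambda>v. v c) -` ball 0 r" by blast
    ultimately show ?thesis by (simp only: openin_open_Int)
  qed
  moreover have "0 \<in> ?U" using subspace_0[OF subL] r(1) by simp
  moreover have "?U \<subseteq> orbit_sum G A \<xi> m"
  proof
    fix v assume v: "v \<in> ?U"
    then have "v c \<in> sumset (rep.orbit (\<xi> c)) m" using r(2) by blast
    then obtain w where w: "v c = (\<Sum>i<m. w i)" "\<forall>i<m. w i \<in> rep.orbit (\<xi> c)"
      unfolding sumset_def by blast
    have "\<exists>g. g \<in> carrier G \<and> w i = Ad G A g \<xi> c" if "i < m" for i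
      using w(2) that tangent_lift_self[OF assms(3) c] unfolding rep.orbit_def by auto
    then obtain g where g: "\<And>i. i < m \<Longrightarrow> g i \<in> carrier G" "\<And>i. i < m \<Longrightarrow> w i = Ad G A (g i) \<xi> c"
      by metis
    \<comment> \<open>So far the decomposition holds only in the chart \<open>c\<close>; both sides
      are tangent vectors at \<open>\<one>\<close>, so it holds in every chart.\<close>
    have "v = (\<Sum>i<m. Ad G A (g i) \<xi>)"
    proof (rule lie_algebra_eqI[OF c])
      show "v \<in> ?L" using v by blast
      show "(\<Sum>i<m. Ad G A (g i) \<xi>) \<in> ?L"
        using g(1) by (intro subspace_sum[OF subL] Ad_in_lie_algebra[OF _ assms(3)]) simp
      show "v c = (\<Sum>i<m. Ad G A (g i) \<xi>) c"
        unfolding sum_fun_apply w(1) using g(2) by (intro sum.cong) auto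
    qed
    moreover have "\<forall>i<m. Ad G A (g i) \<xi> \<in> adjoint_orbit G A \<xi>"
      unfolding adjoint_orbit_def using g(1) by blast
    ultimately show "v \<in> orbit_sum G A \<xi> m" unfolding orbit_sum_def by blast
  qed
  ultimately show ?thesis using m by blast
qed

end
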